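(* There is a constant $C_\Phi>0$, depending only on the root system $\Phi$, such that for every $\lambda\in V^*$ and every $X\in V$, $$|A_\lambda^\Phi(X)|\le C_\Phi\sum_{w\in W}\ \prod_{\alpha\in\Phi^+}\min\bigl\{1,\ |\alpha(X)|\,|\langle w\lambda,\alpha^\vee\rangle|\bigr\}.$$
   Context: $V$ is a finite-dimensional Euclidean space with inner product $\langle\cdot,\cdot\rangle$, $V^*$ its dual; the inner product is used to identify $V$ with $V^*$ when convenient, and $\langle\lambda,X\rangle=\lambda(X)$ for $\lambda\in V^*$, $X\in V$. $\Phi\subset V^*$ is a reduced crystallographic root system (not required to span $V^*$), $\Phi^+$ a positive system. For $\alpha\in\Phi$, $\alpha^\vee=2\alpha/\langle\alpha,\alpha\rangle$ and $s_\alpha X=X-\alpha(X)\alpha^\vee$. $W$ is the Weyl group generated by the $s_\alpha$, acting orthogonally on $V$ and $V^*$. The Weyl alternant is $$A_\lambda^\Phi(X)=\sum_{w\in W}\det(w)\,e^{i\langle w\lambda,X\rangle},\qquad \lambda\in V^*,\ X\in V.$$ *)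

theory Defs
  imports "HOL-Analysis.Analysis"
begin

text \<open>
  The dual space is identified with the Euclidean space itself through the inner product: a
  covector \<open>\<mu>\<close> is represented by the vector for which \<open>\<mu>(X) = \<mu> \<bullet> X\<close>. Under this identification
  the contragredient action \<open>(w \<mu>)(X) = \<mu>(w\<^sup>-\<^sup>1 X)\<close> of an orthogonal map \<open>w\<close> is just
  application of \<open>w\<close> to the vector \<open>\<mu>\<close>.
\<close>

definition coroot :: "'a::euclidean_space \<Rightarrow> 'a" where
  "coroot \<alpha> = (2 / (\<alpha> \<bullet> \<alpha>)) *\<^sub>R \<alpha>"

definition root_reflection :: "'a::euclidean_space \<Rightarrow> 'a \<Rightarrow> 'a" where
  "root_reflection \<alpha> X = X - (\<alpha> \<bullet> X) *\<^sub>R coroot \<alpha>"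

text \<open>Reduced crystallographic root system; the roots need not span the space.\<close>

definition root_system :: "'a::euclidean_space set \<Rightarrow> bool" where
  "root_system \<Phi> \<longleftrightarrow>
     finite \<Phi> \<and> 0 \<notin> \<Phi> \<and>
     (\<forall>\<alpha>\<in>\<Phi>. root_reflection \<alpha> ` \<Phi> = \<Phi>) \<and>
     (\<forall>\<alpha>\<in>\<Phi>. \<forall>\<beta>\<in>\<Phi>. \<beta> \<bullet> coroot \<alpha> \<in> \<int>) \<and>
     (\<forall>\<alpha>\<in>\<Phi>. \<forall>c::real. c *\<^sub>R \<alpha> \<in> \<Phi> \<longrightarrow> c = 1 \<or> c = -1)"

definition positive_system :: "'a::euclidean_space set \<Rightarrow> 'a set \<Rightarrow> bool" where
  "positive_system \<Phi> P \<longleftrightarrow>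
     (\<exists>H. (\<forall>\<alpha>\<in>\<Phi>. \<alpha> \<bullet> H \<noteq> 0) \<and> P = {\<alpha> \<in> \<Phi>. \<alpha> \<bullet> H > 0})"

text \<open>Reflections are involutions, so closure under inverses is automatic.\<close>

inductive_set weyl_group :: "('a::euclidean_space) set \<Rightarrow> ('a \<Rightarrow> 'a) set"
  for \<Phi> :: "'a set" where
  weyl_id: "id \<in> weyl_group \<Phi>"
| weyl_refl: "\<alpha> \<in> \<Phi> \<Longrightarrow> root_reflection \<alpha> \<in> weyl_group \<Phi>"
| weyl_comp: "v \<in> weyl_group \<Phi> \<Longrightarrow> w \<in> weyl_group \<Phi> \<Longrightarrow> v \<circ> w \<in> weyl_group \<Phi>"

text \<open>
  Determinant of an endomorphism: the Leibniz formula in the standard orthonormal basis, since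
  the determinant in \<open>HOL-Analysis\<close> is only available for matrices indexed by types.
\<close>

definition linear_det :: "('a::euclidean_space \<Rightarrow> 'a) \<Rightarrow> real" where
  "linear_det f = (\<Sum>p | p permutes Basis. of_int (sign p) * (\<Prod>b\<in>Basis. f (p b) \<bullet> b))"

definition weyl_alternant ::
    "'a::euclidean_space set \<Rightarrow> 'a \<Rightarrow> 'a \<Rightarrow> complex" where
  "weyl_alternant \<Phi> \<mu> X =
     (\<Sum>w\<in>weyl_group \<Phi>. of_real (linear_det w) * exp (\<i> * of_real (w \<mu> \<bullet> X)))"

text \<open>Consistency with the library determinant, and finiteness of the Weyl group, so that sums
  over it are genuine.\<close>

lemma linear_det_eq_det:
  fixes f :: "real^'n \<Rightarrow> real^'n"
  shows "linear_det f = det (matrix f)"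
proof -
  define ax :: "'n \<Rightarrow> real^'n" where "ax i = axis i 1" for i
  have inj: "inj ax" by (auto simp: inj_def ax_def axis_eq_axis)
  have bas: "(Basis :: (real^'n) set) = ax ` UNIV"
    by (auto simp: Basis_vec_def ax_def)
  have bij: "bij_betw ax UNIV Basis"
    using inj bas by (simp add: bij_betw_def)
  define h where "h p = (\<lambda>x. if x \<in> Basis then ax (p (inv_into UNIV ax x)) else x)" for p :: "'n \<Rightarrow> 'n"
  have hb: "bij_betw h {p. p permutes UNIV} {p. p permutes Basis}"
    unfolding h_def using bij_betw_permutations[OF bij] by simp
  have inv: "inv_into UNIV ax (ax i) = i" for i using inj by simp
  have hax: "h p (ax i) = ax (p i)" for p i by (simp add: h_def inv bas)
  have h_map: "h p = map_permutation UNIV ax p" for p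
    by (auto simp: h_def map_permutation_def restrict_id_def bas fun_eq_iff)
  have sgn: "sign (h p) = sign p" if "p permutes (UNIV :: 'n set)" for p
    unfolding h_map using inj that by (intro sign_map_permutation) auto
  have "linear_det f = (\<Sum>p | p permutes (UNIV :: 'n set).
      of_int (sign (h p)) * (\<Prod>b\<in>Basis. f (h p b) \<bullet> b))"
    unfolding linear_det_def by (rule sum.reindex_bij_betw[OF hb, symmetric])
  also have "\<dots> = (\<Sum>p | p permutes (UNIV :: 'n set).
      of_int (sign p) * (\<Prod>i\<in>UNIV. matrix f $ i $ p i))"
  proof (rule sum.cong[OF refl])
    fix p assume "p \<in> {p. p permutes (UNIV :: 'n set)}"
    moreover have "(\<Prod>b\<in>Basis. f (h p b) \<bullet> b) = (\<Prod>i\<in>UNIV. f (h p (ax i)) \<bullet> ax i)"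
      by (rule prod.reindex_bij_betw[OF bij, symmetric])
    moreover have "\<dots> = (\<Prod>i\<in>UNIV. matrix f $ i $ p i)"
      unfolding hax by (simp add: ax_def matrix_def inner_axis)
    ultimately show "of_int (sign (h p)) * (\<Prod>b\<in>Basis. f (h p b) \<bullet> b)
        = of_int (sign p) * (\<Prod>i\<in>UNIV. matrix f $ i $ p i)"
      by (simp add: sgn)
  qed
  finally show ?thesis by (simp add: det_def)
qed

lemma linear_root_reflection: "linear (root_reflection \<alpha>)"
  unfolding root_reflection_def
  by (rule linearI) (simp_all add: algebra_simps inner_add_right)

lemma weyl_group_action:
  assumes "root_system \<Phi>" "w \<in> weyl_group \<Phi>"
  shows "linear w \<and> w ` \<Phi> = \<Phi> \<and> (\<forall>x. (\<forall>\<alpha>\<in>\<Phi>. \<alpha> \<bullet> x = 0) \<longrightarrow> w x = x)"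
  using assms(2)
proof induct
  case weyl_id
  then show ?case by (auto simp: id_def intro: linear_id[unfolded id_def])
next
  case (weyl_refl \<alpha>)
  then show ?case
    using assms linear_root_reflection[of \<alpha>] unfolding root_system_def
    by (metis root_reflection_def diff_zero scaleR_zero_left)
next
  case (weyl_comp v w)
  then have "linear (v \<circ> w)" by (simp add: linear_compose)
  moreover have "(v \<circ> w) ` \<Phi> = \<Phi>" using weyl_comp by (metis image_comp)
  moreover have "(v \<circ> w) x = x" if "\<forall>\<alpha>\<in>\<Phi>. \<alpha> \<bullet> x = 0" for x
    using weyl_comp that by simp
  ultimately show ?case by blast
qed

lemma finite_weyl_group:
  assumes "root_system \<Phi>"
  shows "finite (weyl_group \<Phi>)"
proof (rule inj_on_finite)
  have fin: "finite \<Phi>" using assms by (simp add: root_system_def)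
  show "finite (\<Phi> \<rightarrow>\<^sub>E \<Phi>)" using fin by (simp add: finite_PiE)
  show "(\<lambda>w. restrict w \<Phi>) ` weyl_group \<Phi> \<subseteq> \<Phi> \<rightarrow>\<^sub>E \<Phi>"
    using weyl_group_action[OF assms] by fastforce
  show "inj_on (\<lambda>w. restrict w \<Phi>) (weyl_group \<Phi>)"
  proof (rule inj_onI)
    fix v w assume vw: "v \<in> weyl_group \<Phi>" "w \<in> weyl_group \<Phi>" "restrict v \<Phi> = restrict w \<Phi>"
    note v = weyl_group_action[OF assms vw(1)] and w = weyl_group_action[OF assms vw(2)]
    have on\<Phi>: "v x = w x" if "x \<in> \<Phi>" for x using vw(3) that by (metis restrict_apply')
    show "v = w"
    proof
      fix x
      obtain y z where yz: "y \<in> span \<Phi>" "\<And>u. u \<in> span \<Phi> \<Longrightarrow> orthogonal z u" "x = y + z"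
        using orthogonal_subspace_decomp_exists[of \<Phi> x] by blast
      have "v y = w y"
        using linear_eq_on[of v w y \<Phi>] v w on\<Phi> yz(1) by blast
      moreover have "\<alpha> \<bullet> z = 0" if "\<alpha> \<in> \<Phi>" for \<alpha>
        using yz(2)[OF span_base[OF that]] by (simp add: orthogonal_def inner_commute)
      then have "v z = z" "w z = z" using v w by auto
      ultimately show "v x = w x" using v w yz(3) by (simp add: linear_add)
    qed
  qed
qed

end

theory Submission
  imports Defs "HOL-Complex_Analysis.Conformal_Mappings"
begin

text \<open>
  The bound is proved by induction on the root system, for alternants \<open>A\<^sub>\<lambda>(X)\<close> whose covector
  \<open>\<lambda> = \<mu> + \<i> \<nu>\<close> is complex. For complex \<open>\<lambda>\<close> the right-hand side carries the extra factor
  \<open>exp (\<Sum>\<^sub>w \<bar>w \<nu> \<bullet> X\<bar>)\<close>, which is \<open>1\<close> for real \<open>\<lambda>\<close>.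

  Fix \<open>X\<close> and let \<open>x\<close> be the largest \<open>\<bar>\<alpha>(X)\<bar>\<close> over the roots. The roots on which \<open>X\<close> is much
  smaller than \<open>x\<close> cannot span all of \<open>\<Phi>\<close>, since otherwise every root, being a bounded combination
  of them, would be small on \<open>X\<close>. The roots in their span therefore form a proper subsystem \<open>\<Psi>\<close>,
  and every other root has \<open>\<bar>\<alpha>(X)\<bar>\<close> comparable to \<open>x\<close> (\<open>exists_proper_flat\<close>). Splitting the Weyl
  group of \<open>\<Phi>\<close> into cosets of that of \<open>\<Psi>\<close> writes \<open>A\<^sub>\<lambda>(X)\<close> as a signed sum of alternants of \<open>\<Psi>\<close> at
  the covectors \<open>w \<lambda>\<close>; by induction this gives the factors of the bound that belong to the positive
  roots of \<open>\<Psi>\<close> (\<open>complex_alternant_le_subsystem\<close>).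

  The missing factors come from antisymmetry in \<open>\<lambda>\<close>: the alternant vanishes whenever \<open>\<lambda>\<close> lies on
  a root hyperplane. Restrict it to a complex line \<open>\<lambda> + z \<eta>\<close> with \<open>\<eta>\<close> regular and
  scaled so that \<open>\<bar>\<eta> \<bullet> \<alpha>\<^sup>\<or>\<bar> \<ge> 1\<close> for all roots. Every positive root
  with \<open>x \<bar>\<langle>\<lambda>, \<alpha>\<^sup>\<or>\<rangle>\<bar> \<le> 1\<close> yields a zero \<open>z\<close> with \<open>\<bar>z\<bar> \<le> \<bar>\<langle>\<lambda>, \<alpha>\<^sup>\<or>\<rangle>\<bar> \<le> 1 / x\<close>. Dividing out these zeros
  and applying the maximum principle on the circle \<open>\<bar>z\<bar> = 2 / x\<close> bounds \<open>\<bar>A\<^sub>\<lambda>(X)\<bar>\<close> by its maximum on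
  that circle times \<open>\<Prod>\<^sub>\<alpha> min 1 (x \<bar>\<langle>\<lambda>, \<alpha>\<^sup>\<or>\<rangle>\<bar>)\<close> (\<open>complex_alternant_le_prod_walls\<close>). On the circle
  the inductive estimate holds with \<open>\<bar>\<langle>w \<lambda>, \<alpha>\<^sup>\<or>\<rangle>\<bar>\<close> enlarged by a multiple of \<open>1 / x\<close>. This enlargement
  does no harm: writing \<open>a = \<bar>\<alpha>(X)\<bar>\<close> and \<open>m = \<bar>\<langle>w \<lambda>, \<alpha>\<^sup>\<or>\<rangle>\<bar>\<close>, the product
  \<open>min 1 (a (m + c / x)) * min 1 (x m)\<close> is at most \<open>(1 + c) min 1 (a m)\<close>, and for a root outside
  \<open>\<Psi>\<close> the factor \<open>min 1 (x m)\<close> alone is comparable to \<open>min 1 (a m)\<close>.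

  The zeros must be distinct for the division, which holds for \<open>\<mu>\<close> outside finitely many
  hyperplanes; both sides are continuous in \<open>\<mu>\<close>, so the bound extends to all \<open>\<mu>\<close>.
\<close>

section \<open>Multiplicativity of the determinant and the sign of a reflection\<close>

text \<open>
  The library determinant needs a finite type of matrix indices; the standard basis itself, made
  into a type, indexes matrices of endomorphisms of an arbitrary Euclidean space.
\<close>

typedef (overloaded) 'a basis_index = "Basis :: 'a::euclidean_space set"
  using nonempty_Basis by blast

instance basis_index :: (euclidean_space) finite
proof
  have "(UNIV :: 'a::euclidean_space basis_index set) = Abs_basis_index ` Basis"
    by (metis Rep_basis_index Rep_basis_index_inverse UNIV_eq_I image_eqI)
  then show "finite (UNIV :: 'a::euclidean_space basis_index set)"
    by (metis finite_Basis finite_imageI)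
qed

lemma bij_betw_Rep_basis_index: "bij_betw Rep_basis_index UNIV (Basis :: 'a::euclidean_space set)"
  by (metis Rep_basis_index_inject bij_betw_def inj_onI type_definition.Rep_range
      type_definition_basis_index)

definition basis_matrix ::
    "('a::euclidean_space \<Rightarrow> 'a) \<Rightarrow> real ^ 'a basis_index ^ 'a basis_index" where
  "basis_matrix f = (\<chi> i j. f (Rep_basis_index j) \<bullet> Rep_basis_index i)"

lemma linear_det_eq_det_basis_matrix: "linear_det f = det (basis_matrix f)"
  for f :: "'a::euclidean_space \<Rightarrow> 'a"
proof -
  let ?R = "Rep_basis_index :: 'a basis_index \<Rightarrow> 'a"
  note bij = bij_betw_Rep_basis_index
  have inj: "inj ?R" and range: "range ?R = Basis"
    using bij by (auto simp: bij_betw_def)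
  have hb: "bij_betw (map_permutation UNIV ?R) {p. p permutes UNIV} {p. p permutes Basis}"
  proof -
    have eq: "(\<lambda>p x. if x \<in> Basis then ?R (p (inv_into UNIV ?R x)) else x) = map_permutation UNIV ?R"
      by (auto simp: map_permutation_def restrict_id_def range fun_eq_iff)
    show ?thesis
      unfolding eq[symmetric] by (rule bij_betw_permutations[OF bij])
  qed
  have sgn: "sign (map_permutation UNIV ?R p) = sign p" if "p permutes UNIV" for p
    using inj that by (intro sign_map_permutation) auto
  have app: "map_permutation UNIV ?R p (?R i) = ?R (p i)" for p i
    using inj by (simp add: map_permutation_def restrict_id_def)
  have prod: "(\<Prod>b\<in>Basis. f (map_permutation UNIV ?R p b) \<bullet> b)
      = (\<Prod>i\<in>UNIV. basis_matrix f $ i $ p i)" for p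
    by (simp add: prod.reindex_bij_betw[OF bij, symmetric] app basis_matrix_def)
  have "linear_det f = (\<Sum>p | p permutes UNIV. of_int (sign (map_permutation UNIV ?R p)) *
      (\<Prod>b\<in>Basis. f (map_permutation UNIV ?R p b) \<bullet> b))"
    unfolding linear_det_def by (rule sum.reindex_bij_betw[OF hb, symmetric])
  also have "\<dots> = det (basis_matrix f)"
    unfolding det_def by (intro sum.cong refl) (simp add: sgn prod)
  finally show ?thesis .
qed

lemma basis_matrix_compose:
  assumes "linear f"
  shows "basis_matrix (f \<circ> g) = basis_matrix f ** basis_matrix g"
proof -
  have expand: "f x \<bullet> b = (\<Sum>k\<in>UNIV. (f (Rep_basis_index k) \<bullet> b) * (x \<bullet> Rep_basis_index k))" for x b
  proof -
    have "f x = f (\<Sum>c\<in>Basis. (x \<bullet> c) *\<^sub>R c)"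
      by (simp add: euclidean_representation)
    also have "\<dots> = (\<Sum>c\<in>Basis. (x \<bullet> c) *\<^sub>R f c)"
      by (simp add: linear_sum[OF assms] linear_scale[OF assms])
    also have "\<dots> = (\<Sum>k\<in>UNIV. (x \<bullet> Rep_basis_index k) *\<^sub>R f (Rep_basis_index k))"
      by (rule sum.reindex_bij_betw[OF bij_betw_Rep_basis_index, symmetric])
    finally show ?thesis
      by (simp add: inner_sum_left mult.commute)
  qed
  show ?thesis
    by (simp add: basis_matrix_def matrix_matrix_mult_def vec_eq_iff) (intro allI expand)
qed

lemma linear_det_compose:
  assumes "linear f"
  shows "linear_det (f \<circ> g) = linear_det f * linear_det g"
  by (simp add: linear_det_eq_det_basis_matrix basis_matrix_compose[OF assms] det_mul)

lemma inner_Rep_basis_index: "Rep_basis_index i \<bullet> Rep_basis_index j = (if i = j then 1 else 0)"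
  by (metis Rep_basis_index Rep_basis_index_inject inner_Basis)

lemma linear_det_id: "linear_det id = 1"
proof -
  have "basis_matrix id = mat 1"
    by (simp add: basis_matrix_def mat_def vec_eq_iff inner_Rep_basis_index)
  then show ?thesis
    by (metis det_I linear_det_eq_det_basis_matrix)
qed

lemma root_reflection_apply:
  "root_reflection \<alpha> X = X - (2 * (\<alpha> \<bullet> X) / (\<alpha> \<bullet> \<alpha>)) *\<^sub>R \<alpha>"
  by (simp add: root_reflection_def coroot_def)

lemma root_reflection_involution: "root_reflection \<alpha> (root_reflection \<alpha> X) = X"
  by (cases "\<alpha> = 0") (simp_all add: root_reflection_apply inner_diff_right)

lemma inner_root_reflection: "root_reflection \<alpha> X \<bullet> root_reflection \<alpha> Y = X \<bullet> Y"
  by (cases "\<alpha> = 0")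
    (simp_all add: root_reflection_apply inner_diff_right inner_diff_left inner_commute field_simps)

lemma root_reflection_scaleR:
  assumes "c \<noteq> 0"
  shows "root_reflection (c *\<^sub>R \<alpha>) = root_reflection \<alpha>"
  using assms by (auto simp: root_reflection_apply fun_eq_iff)

lemma linear_det_reflection_basis:
  assumes "b \<in> Basis"
  shows "linear_det (root_reflection b) = -1"
proof -
  obtain k where k: "b = Rep_basis_index k"
    using assms by (metis Abs_basis_index_inverse)
  have entries: "basis_matrix (root_reflection b) $ i $ j =
      (if i = j then if i = k then -1 else 1 else 0)" for i j
    by (auto simp: basis_matrix_def root_reflection_apply k inner_diff_left inner_Rep_basis_index)
  have "det (basis_matrix (root_reflection b)) = (\<Prod>i\<in>UNIV. if i = k then -1 else 1)"
    by (subst det_diagonal) (auto simp: entries)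
  also have "\<dots> = -1"
    by simp
  finally show ?thesis
    by (simp add: linear_det_eq_det_basis_matrix)
qed

text \<open>
  In a direction of the standard basis the matrix of a reflection is diagonal. Any other \<open>\<alpha>\<close> is
  reduced to this case by conjugation: the reflection in \<open>\<gamma> = \<alpha> - \<beta>\<close> swaps \<open>\<alpha>\<close> with the multiple \<open>\<beta>\<close>
  of a basis vector that has the same norm, and its determinant squares to \<open>1\<close>.
\<close>

lemma linear_det_root_reflection:
  assumes "\<alpha> \<noteq> 0"
  shows "linear_det (root_reflection \<alpha>) = -1"
proof -
  obtain b :: 'a where b: "b \<in> Basis"
    using nonempty_Basis by blast
  define \<beta> where "\<beta> = norm \<alpha> *\<^sub>R b"
  have refl\<beta>: "linear_det (root_reflection \<beta>) = -1"
    unfolding \<beta>_def using assms b by (simp add: root_reflection_scaleR linear_det_reflection_basis)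
  show ?thesis
  proof (cases "\<alpha> = \<beta>")
    case True
    then show ?thesis using refl\<beta> by simp
  next
    case False
    define \<gamma> where "\<gamma> = \<alpha> - \<beta>"
    let ?r = root_reflection
    have nn: "\<beta> \<bullet> \<beta> = \<alpha> \<bullet> \<alpha>"
      using b by (simp add: \<beta>_def power2_norm_eq_inner flip: power2_eq_square)
    have \<gamma>\<gamma>: "\<gamma> \<bullet> \<gamma> = 2 * (\<gamma> \<bullet> \<alpha>)"
      using nn by (simp add: \<gamma>_def algebra_simps inner_diff_left inner_diff_right inner_commute)
    have "\<gamma> \<bullet> \<gamma> \<noteq> 0"
      using False by (simp add: \<gamma>_def)
    then have swap: "?r \<gamma> \<alpha> = \<beta>"
      using \<gamma>\<gamma> by (simp add: root_reflection_apply) (simp add: \<gamma>_def)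
    have conj: "?r \<gamma> \<circ> (?r \<alpha> \<circ> ?r \<gamma>) = ?r \<beta>"
    proof
      fix x
      have 1: "\<alpha> \<bullet> ?r \<gamma> x = \<beta> \<bullet> x"
        by (metis inner_root_reflection root_reflection_involution swap)
      have "?r \<gamma> (?r \<alpha> (?r \<gamma> x)) = ?r \<gamma> (?r \<gamma> x) - (2 * (\<beta> \<bullet> x) / (\<alpha> \<bullet> \<alpha>)) *\<^sub>R ?r \<gamma> \<alpha>"
        by (simp add: root_reflection_apply[of \<alpha>] 1 linear_diff[OF linear_root_reflection]
            linear_scale[OF linear_root_reflection])
      also have "\<dots> = ?r \<beta> x"
        by (simp add: swap root_reflection_involution root_reflection_apply[of \<beta>] nn)
      finally show "(?r \<gamma> \<circ> (?r \<alpha> \<circ> ?r \<gamma>)) x = ?r \<beta> x"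
        by simp
    qed
    have "?r \<gamma> \<circ> ?r \<gamma> = id"
      by (auto simp: root_reflection_involution)
    then have sq: "linear_det (?r \<gamma>) * linear_det (?r \<gamma>) = 1"
      by (metis linear_det_compose linear_det_id linear_root_reflection)
    have "linear_det (?r \<beta>) = linear_det (?r \<gamma>) * (linear_det (?r \<alpha>) * linear_det (?r \<gamma>))"
      by (metis conj linear_det_compose linear_root_reflection)
    also have "\<dots> = linear_det (?r \<alpha>)"
      using sq by (metis mult.commute mult.left_commute mult.right_neutral)
    finally show ?thesis
      using refl\<beta> by simp
  qed
qed

section \<open>The Weyl group and products over positive roots\<close>

lemma weyl_group_inner:
  assumes "w \<in> weyl_group \<Phi>"
  shows "w X \<bullet> w Y = X \<bullet> Y"
  using assms by (induction arbitrary: X Y) (simp_all add: inner_root_reflection)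

lemma weyl_group_linear:
  assumes "w \<in> weyl_group \<Phi>"
  shows "linear w"
  using assms
proof induction
  case weyl_id
  show ?case by (rule linear_id)
next
  case (weyl_comp v w)
  show ?case by (rule linear_compose[OF weyl_comp.IH(2,1)])
qed (rule linear_root_reflection)

lemma weyl_group_inj:
  assumes "w \<in> weyl_group \<Phi>"
  shows "inj w"
  using assms
proof induction
  case (weyl_refl \<alpha>)
  show ?case by (rule inj_on_inverseI[where g = "root_reflection \<alpha>"]) (rule root_reflection_involution)
next
  case (weyl_comp v w)
  show ?case by (rule inj_compose[OF weyl_comp.IH])
qed simp

lemma weyl_group_surj:
  assumes "w \<in> weyl_group \<Phi>"
  shows "surj w"
  using assms
proof induction
  case (weyl_refl \<alpha>)
  show ?case by (rule surjI[where f = "root_reflection \<alpha>"]) (rule root_reflection_involution)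
next
  case (weyl_comp v w)
  show ?case by (rule comp_surj[OF weyl_comp.IH(2,1)])
qed simp

lemma weyl_group_mono:
  assumes "\<Psi> \<subseteq> \<Phi>"
  shows "weyl_group \<Psi> \<subseteq> weyl_group \<Phi>"
proof
  fix w assume "w \<in> weyl_group \<Psi>"
  then show "w \<in> weyl_group \<Phi>"
    using assms by induction (auto intro: weyl_group.intros)
qed

lemma weyl_group_empty: "weyl_group {} = {id}"
proof -
  have "w = id" if "w \<in> weyl_group {}" for w :: "'a \<Rightarrow> 'a"
    using that by induction auto
  then show ?thesis
    by (auto intro: weyl_group.intros)
qed

lemma abs_linear_det_weyl_group:
  assumes "0 \<notin> \<Phi>" "w \<in> weyl_group \<Phi>"
  shows "\<bar>linear_det w\<bar> = 1"
  using assms(2)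
proof induction
  case (weyl_refl \<alpha>)
  then have "\<alpha> \<noteq> 0" using assms(1) by blast
  then show ?case by (simp add: linear_det_root_reflection)
next
  case (weyl_comp v w)
  then show ?case
    by (metis abs_mult linear_det_compose mult_1 weyl_group_linear)
qed (metis abs_one linear_det_id)

lemma bij_betw_weyl_group_left:
  assumes "root_system \<Phi>" "u \<in> weyl_group \<Phi>"
  shows "bij_betw (\<lambda>w. u \<circ> w) (weyl_group \<Phi>) (weyl_group \<Phi>)"
proof -
  have "inj_on (\<lambda>w. u \<circ> w) (weyl_group \<Phi>)"
    using weyl_group_inj[OF assms(2)] by (auto simp: inj_on_def fun_eq_iff)
  moreover have "(\<lambda>w. u \<circ> w) ` weyl_group \<Phi> \<subseteq> weyl_group \<Phi>"
    using assms(2) by (auto intro: weyl_group.intros)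
  ultimately show ?thesis
    by (simp add: bij_betw_def endo_inj_surj finite_weyl_group[OF assms(1)])
qed

lemma inj_comp_right:
  assumes "surj u"
  shows "inj_on (\<lambda>w. w \<circ> u) A"
  using assms by (metis fun.inj_map_strong inj_onI surj_fun_eq)

lemma bij_betw_weyl_group_right:
  assumes "root_system \<Phi>" "u \<in> weyl_group \<Phi>"
  shows "bij_betw (\<lambda>w. w \<circ> u) (weyl_group \<Phi>) (weyl_group \<Phi>)"
proof -
  have "inj_on (\<lambda>w. w \<circ> u) (weyl_group \<Phi>)"
    by (rule inj_comp_right[OF weyl_group_surj[OF assms(2)]])
  moreover have "(\<lambda>w. w \<circ> u) ` weyl_group \<Phi> \<subseteq> weyl_group \<Phi>"
    using assms(2) by (auto intro: weyl_group.intros)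
  ultimately show ?thesis
    by (simp add: bij_betw_def endo_inj_surj finite_weyl_group[OF assms(1)])
qed

lemma weyl_group_image_span:
  assumes "root_system \<Phi>" "w \<in> weyl_group \<Phi>" "v \<in> span \<Phi>"
  shows "w v \<in> span \<Phi>"
  by (metis assms image_eqI linear_span_image weyl_group_action)

lemma coroot_image:
  assumes "w \<in> weyl_group \<Phi>"
  shows "coroot (w \<alpha>) = w (coroot \<alpha>)"
  using assms by (simp add: coroot_def weyl_group_inner weyl_group_linear linear_scale)

lemma root_system_uminus:
  assumes "root_system \<Phi>" "\<alpha> \<in> \<Phi>"
  shows "- \<alpha> \<in> \<Phi>"
proof -
  have "root_reflection \<alpha> \<alpha> \<in> \<Phi>" "\<alpha> \<noteq> 0"
    using assms unfolding root_system_def by blast+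
  moreover have "root_reflection \<alpha> \<alpha> = - \<alpha>" if "\<alpha> \<noteq> 0"
    using that by (simp add: root_reflection_apply scaleR_2)
  ultimately show ?thesis
    by simp
qed

lemma root_system_Int_span:
  assumes "root_system \<Phi>"
  shows "root_system (\<Phi> \<inter> span S)"
proof -
  have "root_reflection \<alpha> ` (\<Phi> \<inter> span S) = \<Phi> \<inter> span S" if "\<alpha> \<in> \<Phi> \<inter> span S" for \<alpha>
  proof -
    have "root_reflection \<alpha> x \<in> \<Phi> \<inter> span S" if "x \<in> \<Phi> \<inter> span S" for x
    proof
      show "root_reflection \<alpha> x \<in> \<Phi>"
        using assms that \<open>\<alpha> \<in> \<Phi> \<inter> span S\<close> unfolding root_system_def by blast
      show "root_reflection \<alpha> x \<in> span S"
        using that \<open>\<alpha> \<in> \<Phi> \<inter> span S\<close>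
        by (auto simp: root_reflection_apply intro!: span_diff span_scale)
    qed
    then show ?thesis
      by (intro bij_betw_imp_surj_on[OF bij_betwI[where g = "root_reflection \<alpha>"]])
        (auto simp: root_reflection_involution)
  qed
  then show ?thesis
    using assms unfolding root_system_def by (simp add: Ball_def) blast
qed

text \<open>
  A Weyl group element permutes all roots but not the positive ones. Passing to the full product,
  which is a square because roots come in pairs \<open>\<plusminus>\<alpha>\<close>, gives invariance of products over positive
  roots without following signs.
\<close>

lemma prod_roots_eq_square:
  fixes h :: "'a::euclidean_space \<Rightarrow> real"
  assumes "root_system \<Phi>" "\<forall>\<alpha>\<in>\<Phi>. \<alpha> \<bullet> H \<noteq> 0" "\<And>\<alpha>. h (- \<alpha>) = h \<alpha>"
  shows "prod h \<Phi> = (prod h {\<alpha>\<in>\<Phi>. \<alpha> \<bullet> H > 0})\<^sup>2"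
proof -
  let ?P = "{\<alpha>\<in>\<Phi>. \<alpha> \<bullet> H > 0}" and ?N = "{\<alpha>\<in>\<Phi>. \<alpha> \<bullet> H < 0}"
  have fin: "finite \<Phi>" using assms(1) by (simp add: root_system_def)
  have "\<Phi> = ?P \<union> ?N" using assms(2) by force
  then have "prod h \<Phi> = prod h (?P \<union> ?N)" by simp
  also have "\<dots> = prod h ?P * prod h ?N"
    by (rule prod.union_disjoint) (use fin in auto)
  also have "prod h ?N = prod h ?P"
    by (rule prod.reindex_bij_witness[of _ uminus uminus])
      (auto simp: assms(3) root_system_uminus[OF assms(1)])
  finally show ?thesis by (simp add: power2_eq_square)
qed

lemma prod_positive_weyl_invariant:
  fixes h :: "'a::euclidean_space \<Rightarrow> real"
  assumes "root_system \<Phi>" "\<forall>\<alpha>\<in>\<Phi>. \<alpha> \<bullet> H \<noteq> 0" "\<And>\<alpha>. h (- \<alpha>) = h \<alpha>" "\<And>\<alpha>. h \<alpha> \<ge> 0"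
    and w: "w \<in> weyl_group \<Phi>"
  shows "(\<Prod>\<alpha> | \<alpha> \<in> \<Phi> \<and> \<alpha> \<bullet> H > 0. h (w \<alpha>)) = (\<Prod>\<alpha> | \<alpha> \<in> \<Phi> \<and> \<alpha> \<bullet> H > 0. h \<alpha>)"
proof -
  have bij: "bij_betw w \<Phi> \<Phi>"
    using weyl_group_action[OF assms(1) w] weyl_group_inj[OF w]
    by (metis bij_betw_def inj_on_subset subset_UNIV)
  have "(\<Prod>\<alpha>\<in>\<Phi>. h (w \<alpha>)) = (\<Prod>\<alpha>\<in>\<Phi>. h \<alpha>)"
    by (rule prod.reindex_bij_betw[OF bij])
  then have "(\<Prod>\<alpha> | \<alpha> \<in> \<Phi> \<and> \<alpha> \<bullet> H > 0. h (w \<alpha>))\<^sup>2 = (\<Prod>\<alpha> | \<alpha> \<in> \<Phi> \<and> \<alpha> \<bullet> H > 0. h \<alpha>)\<^sup>2"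
    using prod_roots_eq_square[OF assms(1,2), of h]
      prod_roots_eq_square[OF assms(1,2), of "\<lambda>\<alpha>. h (w \<alpha>)"]
    by (simp add: assms(3) linear_neg[OF weyl_group_linear[OF w]])
  then show ?thesis
    by (meson assms(4) power2_eq_imp_eq prod_nonneg)
qed

section \<open>Analytic and linear estimates\<close>

text \<open>
  A quantitative Schwarz lemma: a zero \<open>a\<close> with \<open>\<bar>a\<bar> \<le> r\<close> can be divided out at the cost of \<open>1 / r\<close> on
  the circle of radius \<open>2 r\<close>, where \<open>\<bar>z - a\<bar> \<ge> r\<close>, and it contributes \<open>\<bar>a\<bar>\<close> at the origin.
\<close>

lemma norm_le_prod_zeros:
  assumes "finite Z" "f holomorphic_on UNIV" "r > 0"
    and "\<And>z. z \<in> Z \<Longrightarrow> f z = 0 \<and> cmod z \<le> r"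
    and "\<And>z. cmod z = 2 * r \<Longrightarrow> cmod (f z) \<le> M"
  shows "cmod (f 0) \<le> M * (\<Prod>z\<in>Z. cmod z / r)"
  using assms(1,2,4,5)
proof (induction Z arbitrary: f M rule: finite_induct)
  case empty
  have "cmod (f 0) \<le> M"
  proof (rule maximum_modulus_frontier[where f = f and \<xi> = 0 and S = "ball 0 (2 * r)"])
    show "f holomorphic_on interior (ball 0 (2 * r))"
      using empty.prems(1) holomorphic_on_subset by blast
    show "continuous_on (closure (ball 0 (2 * r))) f"
      using empty.prems(1) holomorphic_on_imp_continuous_on holomorphic_on_subset by blast
    show "cmod (f z) \<le> M" if "z \<in> frontier (ball 0 (2 * r))" for z
      using that \<open>r > 0\<close> empty.prems(3) by (simp add: frontier_ball)
  qed (use \<open>r > 0\<close> in auto)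
  then show ?case
    by simp
next
  case (insert a Z)
  define g where "g z = (if z = a then deriv f a else (f z - f a) / (z - a))" for z
  have fa: "f a = 0" "cmod a \<le> r"
    using insert.prems(2) by auto
  have hol: "g holomorphic_on UNIV"
    unfolding g_def by (rule pole_lemma) (use insert.prems(1) in auto)
  have fg: "f z = g z * (z - a)" for z
    by (auto simp: g_def fa)
  have "cmod (g 0) \<le> M / r * (\<Prod>z\<in>Z. cmod z / r)"
  proof (rule insert.IH[OF hol])
    show "g z = 0 \<and> cmod z \<le> r" if "z \<in> Z" for z
      using insert.prems(2)[of z] that insert.hyps(2) by (auto simp: g_def fa)
    show "cmod (g z) \<le> M / r" if z: "cmod z = 2 * r" for z
    proof -
      have "r \<le> cmod (z - a)"
        using norm_triangle_ineq2[of z a] z fa(2) by linarith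
      then have "cmod (g z) * r \<le> cmod (f z)"
        by (simp add: fg norm_mult mult_left_mono)
      also have "\<dots> \<le> M"
        using insert.prems(3) z by blast
      finally show ?thesis
        using \<open>r > 0\<close> by (simp add: field_simps)
    qed
  qed
  then have "cmod (g 0) * cmod a \<le> M / r * (\<Prod>z\<in>Z. cmod z / r) * cmod a"
    by (rule mult_right_mono) simp
  then show ?case
    using insert.hyps by (simp add: fg[of 0] norm_mult mult_ac)
qed

lemma uniform_constant:
  fixes Q :: "'b \<Rightarrow> real \<Rightarrow> bool"
  assumes "finite F" "\<And>y. y \<in> F \<Longrightarrow> \<exists>C. Q y C" "\<And>y C C'. Q y C \<Longrightarrow> C \<le> C' \<Longrightarrow> Q y C'"
  shows "\<exists>C\<ge>1. \<forall>y\<in>F. Q y C"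
  using assms(1,2)
proof (induction F rule: finite_induct)
  case (insert y F)
  then obtain C where C: "C \<ge> 1" "\<forall>y\<in>F. Q y C"
    by auto
  moreover obtain D where "Q y D"
    using insert.prems by blast
  ultimately show ?case
    using assms(3) by (intro exI[of _ "max C D"]) (fastforce simp: le_max_iff_disj)
qed auto

lemma span_inner_bound:
  fixes v :: "'a::euclidean_space"
  assumes "v \<in> span S"
  shows "\<exists>B. \<forall>X m. 0 \<le> m \<longrightarrow> (\<forall>s\<in>S. \<bar>s \<bullet> X\<bar> \<le> m) \<longrightarrow> \<bar>v \<bullet> X\<bar> \<le> B * m"
  using assms
proof (induction rule: span_induct_alt)
  case base
  show ?case by (intro exI[of _ 0]) simp
next
  case (step c s v)
  then obtain B where B: "\<And>X m. 0 \<le> m \<Longrightarrow> \<forall>s\<in>S. \<bar>s \<bullet> X\<bar> \<le> m \<Longrightarrow> \<bar>v \<bullet> X\<bar> \<le> B * m"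
    by blast
  have "\<bar>(c *\<^sub>R s + v) \<bullet> X\<bar> \<le> (\<bar>c\<bar> + B) * m" if "0 \<le> m" "\<forall>s\<in>S. \<bar>s \<bullet> X\<bar> \<le> m" for X m
  proof -
    have "\<bar>(c *\<^sub>R s + v) \<bullet> X\<bar> \<le> \<bar>c\<bar> * \<bar>s \<bullet> X\<bar> + \<bar>v \<bullet> X\<bar>"
      by (metis abs_mult abs_triangle_ineq inner_add_left inner_scaleR_left)
    also have "\<dots> \<le> \<bar>c\<bar> * m + B * m"
      using that step(1) B by (intro add_mono mult_left_mono) auto
    finally show ?thesis
      by (simp add: algebra_simps)
  qed
  then show ?case
    by blast
qed

lemma span_inner_bound_uniform:
  fixes T :: "'a::euclidean_space set"
  assumes "finite T" "T \<subseteq> span S"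
  shows "\<exists>B\<ge>1. \<forall>v\<in>T. \<forall>X m. 0 \<le> m \<longrightarrow> (\<forall>s\<in>S. \<bar>s \<bullet> X\<bar> \<le> m) \<longrightarrow> \<bar>v \<bullet> X\<bar> \<le> B * m"
proof (rule uniform_constant[OF assms(1)])
  show "\<exists>B. \<forall>X m. 0 \<le> m \<longrightarrow> (\<forall>s\<in>S. \<bar>s \<bullet> X\<bar> \<le> m) \<longrightarrow> \<bar>v \<bullet> X\<bar> \<le> B * m" if "v \<in> T" for v
    using span_inner_bound assms(2) that by blast
qed (meson mult_right_mono order_trans)

text \<open>
  The separation of scales behind the induction. Let \<open>S\<close> consist of the roots that are small on
  \<open>X\<close>, relative to the maximum \<open>x\<close>. A root in the span of \<open>S\<close> is at most a constant times as large on \<open>X\<close>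
  as the members of \<open>S\<close>, and there are only finitely many choices of \<open>S\<close>, so with a small enough
  threshold the root attaining \<open>x\<close> lies outside the span.
\<close>

lemma exists_proper_flat:
  fixes \<Phi> :: "'a::euclidean_space set"
  assumes "finite \<Phi>"
  shows "\<exists>L\<ge>1. \<forall>X. \<forall>x>0. (\<forall>\<alpha>\<in>\<Phi>. \<bar>\<alpha> \<bullet> X\<bar> \<le> x) \<longrightarrow> (\<exists>\<alpha>\<in>\<Phi>. \<bar>\<alpha> \<bullet> X\<bar> = x) \<longrightarrow>
    (\<exists>S\<subseteq>\<Phi>. \<not> \<Phi> \<subseteq> span S \<and> (\<forall>\<alpha>\<in>\<Phi> - span S. x \<le> L * \<bar>\<alpha> \<bullet> X\<bar>))"
proof -
  have "\<exists>B\<ge>1. \<forall>S\<in>Pow \<Phi>. \<forall>v\<in>\<Phi> \<inter> span S. \<forall>X m. 0 \<le> m \<longrightarrow> (\<forall>s\<in>S. \<bar>s \<bullet> X\<bar> \<le> m) \<longrightarrow>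
      \<bar>v \<bullet> X\<bar> \<le> B * m"
  proof (rule uniform_constant)
    show "\<exists>B. \<forall>v\<in>\<Phi> \<inter> span S. \<forall>X m. 0 \<le> m \<longrightarrow> (\<forall>s\<in>S. \<bar>s \<bullet> X\<bar> \<le> m) \<longrightarrow> \<bar>v \<bullet> X\<bar> \<le> B * m"
      for S
      using span_inner_bound_uniform[of "\<Phi> \<inter> span S" S] assms by auto
  qed (use assms in simp, meson mult_right_mono order_trans)
  then obtain B where "B \<ge> 1" and B: "\<And>S v X m. S \<subseteq> \<Phi> \<Longrightarrow> v \<in> \<Phi> \<inter> span S \<Longrightarrow> 0 \<le> m \<Longrightarrow>
      \<forall>s\<in>S. \<bar>s \<bullet> X\<bar> \<le> m \<Longrightarrow> \<bar>v \<bullet> X\<bar> \<le> B * m"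
    by (metis PowI)
  have "\<exists>S\<subseteq>\<Phi>. \<not> \<Phi> \<subseteq> span S \<and> (\<forall>\<alpha>\<in>\<Phi> - span S. x \<le> (2 * B) * \<bar>\<alpha> \<bullet> X\<bar>)"
    if "x > 0" "\<beta> \<in> \<Phi>" "\<bar>\<beta> \<bullet> X\<bar> = x" for X x \<beta>
  proof (intro exI[of _ "{\<alpha>\<in>\<Phi>. \<bar>\<alpha> \<bullet> X\<bar> \<le> x / (2 * B)}"] conjI)
    let ?S = "{\<alpha>\<in>\<Phi>. \<bar>\<alpha> \<bullet> X\<bar> \<le> x / (2 * B)}"
    show "\<not> \<Phi> \<subseteq> span ?S"
    proof
      assume "\<Phi> \<subseteq> span ?S"
      then have "\<bar>\<beta> \<bullet> X\<bar> \<le> B * (x / (2 * B))"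
        using that \<open>B \<ge> 1\<close> by (intro B[of ?S]) auto
      then show False
        using that \<open>B \<ge> 1\<close> by simp
    qed
    have "x < (2 * B) * \<bar>\<alpha> \<bullet> X\<bar>" if "\<alpha> \<in> \<Phi> - ?S" for \<alpha>
      using that \<open>B \<ge> 1\<close> by (simp add: not_le field_simps)
    then show "\<forall>\<alpha>\<in>\<Phi> - span ?S. x \<le> (2 * B) * \<bar>\<alpha> \<bullet> X\<bar>"
      by (meson Diff_iff less_imp_le span_base)
  qed auto
  then show ?thesis
    using \<open>B \<ge> 1\<close> by (intro exI[of _ "2 * B"] conjI allI impI) (linarith, blast)
qed

lemma dense_off_hyperplanes:
  fixes S :: "'a::euclidean_space set"
  assumes "finite S" "0 \<notin> S"
  shows "closure {x. \<forall>v\<in>S. v \<bullet> x \<noteq> 0} = UNIV"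
  using assms
proof (induction S rule: finite_induct)
  case (insert v S)
  let ?U = "{x. v \<bullet> x \<noteq> 0}" and ?T = "{x. \<forall>v\<in>S. v \<bullet> x \<noteq> 0}"
  have "?U = - {x. v \<bullet> x = 0}"
    by auto
  then have U: "open ?U" "closure ?U = UNIV"
    using insert.prems by (auto simp: closure_complement interior_hyperplane closed_hyperplane)
  have "closure ?T = UNIV"
    using insert by simp
  then have "?U \<subseteq> closure (?U \<inter> ?T)"
    using open_Int_closure_subset[OF U(1), of ?T] by simp
  then have "closure ?U \<subseteq> closure (?U \<inter> ?T)"
    by (rule closure_minimal) simp
  moreover have "?U \<inter> ?T = {x. \<forall>v\<in>insert v S. v \<bullet> x \<noteq> 0}"
    by auto
  ultimately show ?case
    by (simp add: U(2) top.extremum_unique)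
qed simp

text \<open>
  Lying in the span of the roots makes \<open>\<bar>\<eta> \<bullet> X\<bar>\<close> controlled by the values of the roots on \<open>X\<close>. The
  projection of a regular vector to that span is still regular, and it can be rescaled.
\<close>

lemma regular_direction_in_span:
  fixes \<Phi> :: "'a::euclidean_space set"
  assumes "finite \<Phi>" "\<forall>\<alpha>\<in>\<Phi>. \<alpha> \<bullet> H \<noteq> 0"
  shows "\<exists>\<eta>\<in>span \<Phi>. \<forall>\<alpha>\<in>\<Phi>. 1 \<le> \<bar>\<eta> \<bullet> coroot \<alpha>\<bar>"
proof -
  obtain y z where yz: "y \<in> span \<Phi>" "\<And>u. u \<in> span \<Phi> \<Longrightarrow> orthogonal z u" "H = y + z"
    using orthogonal_subspace_decomp_exists[of \<Phi> H] by blast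
  have nz: "y \<bullet> coroot \<alpha> \<noteq> 0" if "\<alpha> \<in> \<Phi>" for \<alpha>
  proof -
    have "z \<bullet> \<alpha> = 0" using yz(2)[OF span_base[OF that]] by (simp add: orthogonal_def)
    then have "y \<bullet> \<alpha> = \<alpha> \<bullet> H" by (simp add: yz(3) inner_add_right inner_commute)
    moreover have "\<alpha> \<bullet> H \<noteq> 0" using assms(2) that by blast
    ultimately show ?thesis by (auto simp: coroot_def)
  qed
  have "\<exists>C\<ge>1. \<forall>\<alpha>\<in>\<Phi>. 1 \<le> C * \<bar>y \<bullet> coroot \<alpha>\<bar>"
  proof (rule uniform_constant[OF assms(1)])
    show "\<exists>C. 1 \<le> C * \<bar>y \<bullet> coroot \<alpha>\<bar>" if "\<alpha> \<in> \<Phi>" for \<alpha>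
      using nz[OF that] by (intro exI[of _ "1 / \<bar>y \<bullet> coroot \<alpha>\<bar>"]) simp
  qed (meson abs_ge_zero mult_right_mono order_trans)
  then obtain C where "C \<ge> 1" "\<forall>\<alpha>\<in>\<Phi>. 1 \<le> C * \<bar>y \<bullet> coroot \<alpha>\<bar>"
    by blast
  then show ?thesis
    using yz(1) by (intro bexI[of _ "C *\<^sub>R y"]) (auto simp: abs_mult span_scale)
qed

section \<open>Alternants at complex covectors\<close>

text \<open>
  The alternant \<open>\<Sum>\<^sub>w det(w) exp(\<i> \<langle>w \<lambda>, X\<rangle>)\<close> at the complex covector \<open>\<lambda> = \<mu> + \<i> \<nu>\<close>, which is kept as
  the pair of its real and imaginary parts because the Weyl group acts on real vectors.
\<close>

definition complex_alternant ::
    "'a::euclidean_space set \<Rightarrow> 'a \<Rightarrow> 'a \<Rightarrow> 'a \<Rightarrow> complex" where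
  "complex_alternant \<Phi> \<mu> \<nu> X =
     (\<Sum>w\<in>weyl_group \<Phi>. of_real (linear_det w) * exp (Complex (- (w \<nu> \<bullet> X)) (w \<mu> \<bullet> X)))"

text \<open>
  This is \<open>\<bar>\<langle>\<mu> + \<i> \<nu>, v\<rangle>\<bar>\<close>.
\<close>

definition pairing_norm :: "'a::euclidean_space \<Rightarrow> 'a \<Rightarrow> 'a \<Rightarrow> real" where
  "pairing_norm \<mu> \<nu> v = cmod (Complex (\<mu> \<bullet> v) (\<nu> \<bullet> v))"

text \<open>
  Each exponential in the alternant has modulus at most \<open>exp (growth \<Phi> \<nu> X)\<close>. Summing over the
  group makes this quantity invariant under \<open>\<nu> \<mapsto> w \<nu>\<close> and monotone in \<open>\<Phi>\<close>.
\<close>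

definition growth :: "'a::euclidean_space set \<Rightarrow> 'a \<Rightarrow> 'a \<Rightarrow> real" where
  "growth \<Phi> \<nu> X = (\<Sum>w\<in>weyl_group \<Phi>. \<bar>w \<nu> \<bullet> X\<bar>)"

lemma pairing_norm_nonneg [simp]: "0 \<le> pairing_norm \<mu> \<nu> v"
  by (simp add: pairing_norm_def)

lemma linear_det_comp_reflection:
  assumes "root_system \<Phi>" "\<alpha> \<in> \<Phi>" "w \<in> weyl_group \<Phi>"
  shows "linear_det (root_reflection \<alpha> \<circ> w) = - linear_det w"
    and "linear_det (w \<circ> root_reflection \<alpha>) = - linear_det w"
proof -
  have "\<alpha> \<noteq> 0" using assms by (auto simp: root_system_def)
  then have "linear_det (root_reflection \<alpha>) = -1" by (rule linear_det_root_reflection)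
  then show "linear_det (root_reflection \<alpha> \<circ> w) = - linear_det w"
    "linear_det (w \<circ> root_reflection \<alpha>) = - linear_det w"
    unfolding linear_det_compose[OF linear_root_reflection]
      linear_det_compose[OF weyl_group_linear[OF assms(3)]] by simp_all
qed

text \<open>
  Here \<open>X\<close> is fixed by the reflection in \<open>\<alpha>\<close>, so that \<open>w \<mapsto> s\<^sub>\<alpha> w\<close> pairs terms of opposite sign; on
  a wall in \<open>\<lambda>\<close> the same is done below by \<open>w \<mapsto> w s\<^sub>\<alpha>\<close>.
\<close>

lemma complex_alternant_eq_0_of_root_zero:
  assumes "root_system \<Phi>" "\<alpha> \<in> \<Phi>" "\<alpha> \<bullet> X = 0"
  shows "complex_alternant \<Phi> \<mu> \<nu> X = 0"
proof -
  let ?r = "root_reflection \<alpha>"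
  let ?t = "\<lambda>w. of_real (linear_det w) * exp (Complex (- (w \<nu> \<bullet> X)) (w \<mu> \<bullet> X))"
  have r: "?r \<in> weyl_group \<Phi>" by (rule weyl_refl[OF assms(2)])
  have "?r X = X" by (simp add: root_reflection_apply assms(3))
  then have inner: "?r v \<bullet> X = v \<bullet> X" for v
    by (metis inner_root_reflection)
  have t: "?t (?r \<circ> w) = - ?t w" if "w \<in> weyl_group \<Phi>" for w
    unfolding linear_det_comp_reflection[OF assms(1,2) that] by (simp add: inner)
  have "complex_alternant \<Phi> \<mu> \<nu> X = (\<Sum>w\<in>weyl_group \<Phi>. ?t (?r \<circ> w))"
    unfolding complex_alternant_def
    by (rule sum.reindex_bij_betw[OF bij_betw_weyl_group_left[OF assms(1) r], symmetric])
  also have "\<dots> = - complex_alternant \<Phi> \<mu> \<nu> X"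
    unfolding complex_alternant_def sum_negf[symmetric] by (intro sum.cong refl t)
  finally show ?thesis by simp
qed

lemma complex_alternant_eq_0_of_wall:
  assumes "root_system \<Phi>" "\<alpha> \<in> \<Phi>" "\<mu> \<bullet> coroot \<alpha> = 0" "\<nu> \<bullet> coroot \<alpha> = 0"
  shows "complex_alternant \<Phi> \<mu> \<nu> X = 0"
proof -
  let ?r = "root_reflection \<alpha>"
  let ?t = "\<lambda>w. of_real (linear_det w) * exp (Complex (- (w \<nu> \<bullet> X)) (w \<mu> \<bullet> X))"
  have r: "?r \<in> weyl_group \<Phi>" by (rule weyl_refl[OF assms(2)])
  have "\<alpha> \<noteq> 0" using assms(1,2) by (auto simp: root_system_def)
  then have "\<alpha> \<bullet> \<mu> = 0" "\<alpha> \<bullet> \<nu> = 0"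
    using assms(3,4) by (auto simp: coroot_def inner_commute)
  then have fixed: "?r \<mu> = \<mu>" "?r \<nu> = \<nu>" by (simp_all add: root_reflection_apply)
  have t: "?t (w \<circ> ?r) = - ?t w" if "w \<in> weyl_group \<Phi>" for w
    unfolding linear_det_comp_reflection[OF assms(1,2) that] by (simp add: fixed)
  have "complex_alternant \<Phi> \<mu> \<nu> X = (\<Sum>w\<in>weyl_group \<Phi>. ?t (w \<circ> ?r))"
    unfolding complex_alternant_def
    by (rule sum.reindex_bij_betw[OF bij_betw_weyl_group_right[OF assms(1) r], symmetric])
  also have "\<dots> = - complex_alternant \<Phi> \<mu> \<nu> X"
    unfolding complex_alternant_def sum_negf[symmetric] by (intro sum.cong refl t)
  finally show ?thesis by simp
qed

text \<open>
  Averaging over the subgroup replaces a choice of coset representatives.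
\<close>

lemma sum_weyl_group_subsystem:
  assumes "root_system \<Phi>" "\<Psi> \<subseteq> \<Phi>"
  shows "(\<Sum>w\<in>weyl_group \<Phi>. \<Sum>u\<in>weyl_group \<Psi>. g (u \<circ> w))
    = of_nat (card (weyl_group \<Psi>)) * (\<Sum>w\<in>weyl_group \<Phi>. g w)"
proof -
  have "(\<Sum>w\<in>weyl_group \<Phi>. g (u \<circ> w)) = (\<Sum>w\<in>weyl_group \<Phi>. g w)" if "u \<in> weyl_group \<Psi>" for u
    using that weyl_group_mono[OF assms(2)]
    by (intro sum.reindex_bij_betw bij_betw_weyl_group_left[OF assms(1)]) auto
  then show ?thesis
    by (subst sum.swap) simp
qed

text \<open>
  The alternant of \<open>\<Phi>\<close> at \<open>\<lambda>\<close> is the sum of the alternants of \<open>\<Psi>\<close> at \<open>w \<lambda>\<close>, with sign \<open>det w\<close>, over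
  representatives \<open>w\<close> of the cosets of the smaller Weyl group. The right-hand sides add up in the same
  way, so the bound passes from \<open>\<Psi>\<close> to \<open>\<Phi>\<close> with the same constant.
\<close>

lemma complex_alternant_le_subsystem:
  assumes "root_system \<Phi>" "root_system \<Psi>" "\<Psi> \<subseteq> \<Phi>" "0 \<le> C"
    and bound: "\<And>\<mu> \<nu>. cmod (complex_alternant \<Psi> \<mu> \<nu> X) \<le>
      C * exp (growth \<Psi> \<nu> X) * (\<Sum>u\<in>weyl_group \<Psi>. G (u \<mu>) (u \<nu>))"
    and G: "\<And>\<mu> \<nu>. 0 \<le> G \<mu> \<nu>"
  shows "cmod (complex_alternant \<Phi> \<mu> \<nu> X) \<le>
    C * exp (growth \<Phi> \<nu> X) * (\<Sum>w\<in>weyl_group \<Phi>. G (w \<mu>) (w \<nu>))"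
proof -
  let ?n = "card (weyl_group \<Psi>)"
  let ?t = "\<lambda>w. of_real (linear_det w) * exp (Complex (- (w \<nu> \<bullet> X)) (w \<mu> \<bullet> X))"
  note sub = weyl_group_mono[OF assms(3)] and fin = finite_weyl_group[OF assms(1)]
  have "id \<in> weyl_group \<Psi>" by (rule weyl_id)
  then have n: "real ?n > 0"
    using finite_weyl_group[OF assms(2)] by (auto simp: card_gt_0_iff)
  have coset: "(\<Sum>u\<in>weyl_group \<Psi>. ?t (u \<circ> w)) =
      of_real (linear_det w) * complex_alternant \<Psi> (w \<mu>) (w \<nu>) X" for w
    unfolding complex_alternant_def sum_distrib_left
    by (intro sum.cong refl, subst linear_det_compose) (auto intro: weyl_group_linear)
  have "real ?n * cmod (complex_alternant \<Phi> \<mu> \<nu> X) =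
      cmod (\<Sum>w\<in>weyl_group \<Phi>. \<Sum>u\<in>weyl_group \<Psi>. ?t (u \<circ> w))"
    unfolding sum_weyl_group_subsystem[OF assms(1,3), of ?t]
    by (simp only: complex_alternant_def norm_mult norm_of_nat)
  also have "\<dots> \<le> (\<Sum>w\<in>weyl_group \<Phi>. cmod (complex_alternant \<Psi> (w \<mu>) (w \<nu>) X))"
  proof (unfold coset, rule sum_norm_le)
    fix w assume "w \<in> weyl_group \<Phi>"
    moreover have "0 \<notin> \<Phi>" using assms(1) by (simp add: root_system_def)
    ultimately show "cmod (of_real (linear_det w) * complex_alternant \<Psi> (w \<mu>) (w \<nu>) X)
        \<le> cmod (complex_alternant \<Psi> (w \<mu>) (w \<nu>) X)"
      by (simp add: norm_mult abs_linear_det_weyl_group)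
  qed
  also have "\<dots> \<le> (\<Sum>w\<in>weyl_group \<Phi>. C * exp (growth \<Phi> \<nu> X) *
      (\<Sum>u\<in>weyl_group \<Psi>. G ((u \<circ> w) \<mu>) ((u \<circ> w) \<nu>)))"
  proof (rule sum_mono)
    fix w assume w: "w \<in> weyl_group \<Phi>"
    have "growth \<Psi> (w \<nu>) X = (\<Sum>v\<in>(\<lambda>u. u \<circ> w) ` weyl_group \<Psi>. \<bar>v \<nu> \<bullet> X\<bar>)"
      using inj_comp_right[OF weyl_group_surj[OF w], of "weyl_group \<Psi>"]
      by (simp add: growth_def sum.reindex)
    also have "\<dots> \<le> growth \<Phi> \<nu> X"
      unfolding growth_def using w sub fin
      by (intro sum_mono2) (auto intro: weyl_comp)
    finally have g: "growth \<Psi> (w \<nu>) X \<le> growth \<Phi> \<nu> X" .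
    have "cmod (complex_alternant \<Psi> (w \<mu>) (w \<nu>) X) \<le>
        C * exp (growth \<Psi> (w \<nu>) X) * (\<Sum>u\<in>weyl_group \<Psi>. G (u (w \<mu>)) (u (w \<nu>)))"
      by (rule bound)
    also have "\<dots> \<le> C * exp (growth \<Phi> \<nu> X) * (\<Sum>u\<in>weyl_group \<Psi>. G (u (w \<mu>)) (u (w \<nu>)))"
      using g assms(4) by (intro mult_right_mono mult_left_mono sum_nonneg G) auto
    finally show "cmod (complex_alternant \<Psi> (w \<mu>) (w \<nu>) X) \<le> C * exp (growth \<Phi> \<nu> X) *
      (\<Sum>u\<in>weyl_group \<Psi>. G ((u \<circ> w) \<mu>) ((u \<circ> w) \<nu>))"
      by simp
  qed
  also have "\<dots> = real ?n * (C * exp (growth \<Phi> \<nu> X) * (\<Sum>w\<in>weyl_group \<Phi>. G (w \<mu>) (w \<nu>)))"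
    unfolding sum_distrib_left[symmetric]
      sum_weyl_group_subsystem[OF assms(1,3), of "\<lambda>w. G (w \<mu>) (w \<nu>)"] by simp
  finally show ?thesis
    using n by simp
qed

text \<open>
  On the line \<open>\<lambda> + z \<eta>\<close> the alternant vanishes where the line meets the wall of \<open>\<alpha>\<close>, at
  \<open>z = - \<langle>\<lambda>, \<alpha>\<^sup>\<or>\<rangle> / (\<eta> \<bullet> \<alpha>\<^sup>\<or>)\<close>, a point no larger than \<open>\<bar>\<langle>\<lambda>, \<alpha>\<^sup>\<or>\<rangle>\<bar>\<close>. The walls met within distance
  \<open>1 / x\<close> give the factors below \<open>1\<close>. The injectivity hypothesis makes these zeros distinct, so that
  no multiplicities arise.
\<close>

lemma complex_alternant_le_prod_walls:
  assumes "root_system \<Phi>" "P \<subseteq> \<Phi>" "x > 0"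
    and \<eta>: "\<forall>\<alpha>\<in>P. 1 \<le> \<bar>\<eta> \<bullet> coroot \<alpha>\<bar>"
    and inj: "inj_on (\<lambda>\<alpha>. (\<mu> \<bullet> coroot \<alpha>) / (\<eta> \<bullet> coroot \<alpha>)) P"
    and M: "\<And>z. cmod z = 2 / x \<Longrightarrow>
      cmod (complex_alternant \<Phi> (\<mu> + Re z *\<^sub>R \<eta>) (\<nu> + Im z *\<^sub>R \<eta>) X) \<le> M"
  shows "cmod (complex_alternant \<Phi> \<mu> \<nu> X) \<le>
    M * (\<Prod>\<alpha>\<in>P. min 1 (x * pairing_norm \<mu> \<nu> (coroot \<alpha>)))"
proof -
  define f where "f z = complex_alternant \<Phi> (\<mu> + Re z *\<^sub>R \<eta>) (\<nu> + Im z *\<^sub>R \<eta>) X" for z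
  define K where "K = {\<alpha>\<in>P. x * pairing_norm \<mu> \<nu> (coroot \<alpha>) \<le> 1}"
  define zero where "zero \<alpha> = Complex (- (\<mu> \<bullet> coroot \<alpha>) / (\<eta> \<bullet> coroot \<alpha>))
    (- (\<nu> \<bullet> coroot \<alpha>) / (\<eta> \<bullet> coroot \<alpha>))" for \<alpha>
  have finP: "finite P"
    using assms(1,2) finite_subset by (auto simp: root_system_def)
  \<comment> \<open>\<open>z\<close> enters each exponent as \<open>\<i> z \<langle>w \<eta>, X\<rangle>\<close>, so \<open>f\<close> is entire.\<close>
  have f_eq: "f z = (\<Sum>w\<in>weyl_group \<Phi>. of_real (linear_det w) *
      exp (Complex (- (w \<nu> \<bullet> X)) (w \<mu> \<bullet> X) + \<i> * z * of_real (w \<eta> \<bullet> X)))" for z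
    unfolding f_def complex_alternant_def
  proof (intro sum.cong refl)
    fix w assume "w \<in> weyl_group \<Phi>"
    then have lin: "linear w" by (rule weyl_group_linear)
    have "Complex (- (w (\<nu> + Im z *\<^sub>R \<eta>) \<bullet> X)) (w (\<mu> + Re z *\<^sub>R \<eta>) \<bullet> X)
        = Complex (- (w \<nu> \<bullet> X)) (w \<mu> \<bullet> X) + \<i> * z * of_real (w \<eta> \<bullet> X)"
      by (simp add: complex_eq_iff linear_add[OF lin] linear_scale[OF lin] inner_add_left)
    then show "of_real (linear_det w) *
        exp (Complex (- (w (\<nu> + Im z *\<^sub>R \<eta>) \<bullet> X)) (w (\<mu> + Re z *\<^sub>R \<eta>) \<bullet> X))
      = of_real (linear_det w) *
        exp (Complex (- (w \<nu> \<bullet> X)) (w \<mu> \<bullet> X) + \<i> * z * of_real (w \<eta> \<bullet> X))"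
      by simp
  qed
  have hol: "f holomorphic_on UNIV"
    unfolding f_eq[abs_def] by (intro holomorphic_intros)
  have "cmod (complex_of_real (2 / x)) = 2 / x"
    using \<open>x > 0\<close> by (subst norm_of_real) simp
  then have M0: "0 \<le> M"
    using M norm_ge_zero order_trans by blast
  have norm_zero: "cmod (zero \<alpha>) \<le> pairing_norm \<mu> \<nu> (coroot \<alpha>)" if "\<alpha> \<in> P" for \<alpha>
  proof -
    have e: "1 \<le> \<bar>\<eta> \<bullet> coroot \<alpha>\<bar>" using \<eta> that by blast
    have "zero \<alpha> = - Complex (\<mu> \<bullet> coroot \<alpha>) (\<nu> \<bullet> coroot \<alpha>) / of_real (\<eta> \<bullet> coroot \<alpha>)"
      by (simp add: zero_def complex_eq_iff)
    then have "cmod (zero \<alpha>) = pairing_norm \<mu> \<nu> (coroot \<alpha>) / \<bar>\<eta> \<bullet> coroot \<alpha>\<bar>"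
      by (simp add: norm_divide pairing_norm_def)
    also have "\<dots> \<le> pairing_norm \<mu> \<nu> (coroot \<alpha>) / 1"
      using e by (intro divide_left_mono) auto
    finally show ?thesis by simp
  qed
  have inj_zero: "inj_on zero K"
    using inj by (auto simp: inj_on_def zero_def K_def)
  have "cmod (f 0) \<le> M * (\<Prod>z\<in>zero ` K. cmod z / (1 / x))"
  proof (rule norm_le_prod_zeros[OF _ hol])
    show "finite (zero ` K)" using finP by (simp add: K_def)
    show "f z = 0 \<and> cmod z \<le> 1 / x" if z: "z \<in> zero ` K" for z
    proof
      obtain \<alpha> where \<alpha>: "\<alpha> \<in> P" "x * pairing_norm \<mu> \<nu> (coroot \<alpha>) \<le> 1" "z = zero \<alpha>"
        using z by (auto simp: K_def)
      have "\<eta> \<bullet> coroot \<alpha> \<noteq> 0" using \<eta> \<alpha>(1) by force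
      then show "f z = 0"
        unfolding f_def \<alpha>(3) using \<alpha>(1) assms(2)
        by (intro complex_alternant_eq_0_of_wall[OF assms(1)])
          (auto simp: zero_def inner_diff_left)
      have "cmod z \<le> pairing_norm \<mu> \<nu> (coroot \<alpha>)"
        using norm_zero \<alpha> by simp
      also have "\<dots> \<le> 1 / x"
        using \<alpha>(2) \<open>x > 0\<close> by (simp add: field_simps)
      finally show "cmod z \<le> 1 / x" .
    qed
    show "cmod (f z) \<le> M" if "cmod z = 2 * (1 / x)" for z
      using M that by (simp add: f_def)
  qed (use \<open>x > 0\<close> in simp)
  also have "(\<Prod>z\<in>zero ` K. cmod z / (1 / x)) = (\<Prod>\<alpha>\<in>K. x * cmod (zero \<alpha>))"
    by (subst prod.reindex[OF inj_zero]) (simp add: mult.commute)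
  also have "\<dots> \<le> (\<Prod>\<alpha>\<in>K. min 1 (x * pairing_norm \<mu> \<nu> (coroot \<alpha>)))"
    using \<open>x > 0\<close> by (intro prod_mono) (auto simp: K_def norm_zero)
  also have "\<dots> = (\<Prod>\<alpha>\<in>P. min 1 (x * pairing_norm \<mu> \<nu> (coroot \<alpha>)))"
    using finP by (intro prod.mono_neutral_left) (auto simp: K_def min_def)
  finally show ?thesis
    using M0 by (simp add: f_def mult_left_mono)
qed

text \<open>
  If \<open>x m \<ge> 1\<close>, the shift \<open>c / x\<close> is at most \<open>c m\<close>; otherwise the second factor is \<open>x m\<close>, which turns the
  shift \<open>c / x\<close> into \<open>c m\<close>.
\<close>

lemma min_mult_min_le:
  fixes a m x c :: real
  assumes "0 \<le> a" "0 \<le> m" "0 < x" "0 \<le> c"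
  shows "min 1 (a * (m + c / x)) * min 1 (x * m) \<le> (1 + c) * min 1 (a * m)"
proof -
  let ?l = "min 1 (a * (m + c / x)) * min 1 (x * m)"
  have nn: "0 \<le> a * (m + c / x)" "0 \<le> x * m" using assms by auto
  have "?l \<le> 1 * 1" using nn by (intro mult_mono) auto
  then have 1: "?l \<le> 1 + c" using assms by simp
  have 2: "?l \<le> (1 + c) * (a * m)"
  proof (cases "1 \<le> x * m")
    case True
    then have "c * 1 \<le> c * (x * m)" using assms by (intro mult_left_mono) auto
    then have "c / x \<le> c * m" using assms by (simp add: field_simps)
    then have "a * (m + c / x) \<le> a * (m + c * m)" using assms by (intro mult_left_mono) auto
    moreover have "?l \<le> a * (m + c / x) * 1" using nn by (intro mult_mono) auto
    ultimately show ?thesis by (simp add: algebra_simps)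
  next
    case False
    have "?l \<le> (a * (m + c / x)) * (x * m)" using nn by (intro mult_mono) auto
    also have "\<dots> = (a * m) * (x * m + c)" using assms by (simp add: field_simps)
    also have "\<dots> \<le> (a * m) * (1 + c)" using assms False by (intro mult_left_mono) auto
    finally show ?thesis by (simp add: mult.commute)
  qed
  show ?thesis using 1 2 by (simp add: min_def)
qed

lemma min_scale_le:
  fixes a m x L :: real
  assumes "0 \<le> m" "1 \<le> L" "x \<le> L * a"
  shows "min 1 (x * m) \<le> L * min 1 (a * m)"
proof -
  have "x * m \<le> (L * a) * m" using assms by (intro mult_right_mono) auto
  then show ?thesis using assms(2) by (auto simp: min_def mult.assoc)
qed

lemma pairing_norm_shift:
  assumes "linear w"
  shows "pairing_norm (w (\<mu> + Re z *\<^sub>R \<eta>)) (w (\<nu> + Im z *\<^sub>R \<eta>)) v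
    \<le> pairing_norm (w \<mu>) (w \<nu>) v + cmod z * \<bar>w \<eta> \<bullet> v\<bar>"
proof -
  have "Complex (w (\<mu> + Re z *\<^sub>R \<eta>) \<bullet> v) (w (\<nu> + Im z *\<^sub>R \<eta>) \<bullet> v)
      = Complex (w \<mu> \<bullet> v) (w \<nu> \<bullet> v) + z * of_real (w \<eta> \<bullet> v)"
    by (simp add: complex_eq_iff linear_add[OF assms] linear_scale[OF assms] inner_add_left)
  then show ?thesis
    unfolding pairing_norm_def by (metis norm_mult norm_of_real norm_triangle_ineq)
qed

section \<open>The inductive bound\<close>

lemma complex_alternant_bound_empty:
  "cmod (complex_alternant {} \<mu> \<nu> X) \<le> exp (growth {} \<nu> X)"
  unfolding complex_alternant_def growth_def weyl_group_empty
  by (simp add: norm_mult linear_det_id[unfolded id_def] id_def)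

text \<open>
  The inductive step at a fixed \<open>X\<close>, assuming the bound for the subsystem \<open>\<Psi>\<close>. The constant \<open>E\<close>
  controls how much \<open>\<langle>w \<lambda>, \<alpha>\<^sup>\<or>\<rangle>\<close> moves on the circle \<open>\<bar>z\<bar> = 2 / x\<close>, and \<open>B\<close> how much the exponential growth
  factor changes there.
\<close>

lemma complex_alternant_bound_generic:
  fixes \<Phi> :: "'a::euclidean_space set"
  assumes \<Phi>: "root_system \<Phi>" and \<Psi>: "root_system \<Psi>" "\<Psi> \<subseteq> \<Phi>"
    and H: "\<forall>\<alpha>\<in>\<Phi>. \<alpha> \<bullet> H \<noteq> 0"
    and P: "P = {\<alpha>\<in>\<Phi>. 0 < \<alpha> \<bullet> H}"
    and C0: "0 \<le> C0" "\<And>\<mu> \<nu>. cmod (complex_alternant \<Psi> \<mu> \<nu> X) \<le> C0 * exp (growth \<Psi> \<nu> X) *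
      (\<Sum>w\<in>weyl_group \<Psi>. \<Prod>\<alpha>\<in>P \<inter> \<Psi>. min 1 (\<bar>\<alpha> \<bullet> X\<bar> * pairing_norm (w \<mu>) (w \<nu>) (coroot \<alpha>)))"
    and x: "0 < x" and L: "1 \<le> L" "\<forall>\<alpha>\<in>P - \<Psi>. x \<le> L * \<bar>\<alpha> \<bullet> X\<bar>"
    and \<eta>: "\<forall>\<alpha>\<in>\<Phi>. 1 \<le> \<bar>\<eta> \<bullet> coroot \<alpha>\<bar>"
    and B: "\<forall>w\<in>weyl_group \<Phi>. \<bar>w \<eta> \<bullet> X\<bar> \<le> B * x"
    and E: "0 \<le> E" "\<forall>w\<in>weyl_group \<Phi>. \<forall>\<alpha>\<in>\<Phi>. \<bar>w \<eta> \<bullet> coroot \<alpha>\<bar> \<le> E"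
    and inj: "inj_on (\<lambda>\<alpha>. (\<mu> \<bullet> coroot \<alpha>) / (\<eta> \<bullet> coroot \<alpha>)) P"
  shows "cmod (complex_alternant \<Phi> \<mu> \<nu> X) \<le>
    C0 * exp (2 * B * card (weyl_group \<Phi>)) * max (1 + 2 * E) L ^ card P * exp (growth \<Phi> \<nu> X) *
    (\<Sum>w\<in>weyl_group \<Phi>. \<Prod>\<alpha>\<in>P. min 1 (\<bar>\<alpha> \<bullet> X\<bar> * pairing_norm (w \<mu>) (w \<nu>) (coroot \<alpha>)))"
proof -
  let ?W = "weyl_group \<Phi>"
  let ?D = "max (1 + 2 * E) L"
  let ?p = "\<lambda>w \<alpha>. pairing_norm (w \<mu>) (w \<nu>) (coroot \<alpha>)"
  have finP: "finite P" using \<Phi> P by (simp add: root_system_def)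
  define c where "c = C0 * exp (2 * B * card ?W) * exp (growth \<Phi> \<nu> X)"
  have c0: "0 \<le> c" using C0(1) by (simp add: c_def)
  define M where "M = c * (\<Sum>w\<in>?W. \<Prod>\<alpha>\<in>P \<inter> \<Psi>. min 1 (\<bar>\<alpha> \<bullet> X\<bar> * (?p w \<alpha> + 2 * E / x)))"
  have "cmod (complex_alternant \<Phi> \<mu> \<nu> X) \<le> M * (\<Prod>\<alpha>\<in>P. min 1 (x * pairing_norm \<mu> \<nu> (coroot \<alpha>)))"
  proof (rule complex_alternant_le_prod_walls[OF \<Phi> _ x _ inj])
    fix z :: complex assume z: "cmod z = 2 / x"
    let ?\<mu> = "\<mu> + Re z *\<^sub>R \<eta>" and ?\<nu> = "\<nu> + Im z *\<^sub>R \<eta>"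
    have "growth \<Phi> ?\<nu> X \<le> (\<Sum>w\<in>?W. \<bar>w \<nu> \<bullet> X\<bar> + 2 * B)"
      unfolding growth_def
    proof (rule sum_mono)
      fix w assume w: "w \<in> ?W"
      note lin = weyl_group_linear[OF w]
      have "\<bar>w ?\<nu> \<bullet> X\<bar> \<le> \<bar>w \<nu> \<bullet> X\<bar> + \<bar>Im z\<bar> * \<bar>w \<eta> \<bullet> X\<bar>"
        by (simp add: linear_add[OF lin] linear_scale[OF lin] inner_add_left flip: abs_mult)
      also have "\<bar>Im z\<bar> * \<bar>w \<eta> \<bullet> X\<bar> \<le> (2 / x) * (B * x)"
        using abs_Im_le_cmod[of z] z B w x by (intro mult_mono) auto
      finally show "\<bar>w ?\<nu> \<bullet> X\<bar> \<le> \<bar>w \<nu> \<bullet> X\<bar> + 2 * B"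
        using x by simp
    qed
    then have growth: "growth \<Phi> ?\<nu> X \<le> 2 * B * card ?W + growth \<Phi> \<nu> X"
      by (simp add: sum.distrib growth_def mult.commute)
    have "cmod (complex_alternant \<Phi> ?\<mu> ?\<nu> X) \<le> C0 * exp (growth \<Phi> ?\<nu> X) *
        (\<Sum>w\<in>?W. \<Prod>\<alpha>\<in>P \<inter> \<Psi>. min 1 (\<bar>\<alpha> \<bullet> X\<bar> * pairing_norm (w ?\<mu>) (w ?\<nu>) (coroot \<alpha>)))"
      by (rule complex_alternant_le_subsystem[OF \<Phi> \<Psi> C0]) (auto intro!: prod_nonneg)
    also have "\<dots> \<le> c * (\<Sum>w\<in>?W. \<Prod>\<alpha>\<in>P \<inter> \<Psi>. min 1 (\<bar>\<alpha> \<bullet> X\<bar> * (?p w \<alpha> + 2 * E / x)))"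
    proof (rule mult_mono)
      show "C0 * exp (growth \<Phi> ?\<nu> X) \<le> c"
        unfolding c_def mult.assoc exp_add[symmetric] using growth C0(1)
        by (intro mult_left_mono) simp_all
      show "(\<Sum>w\<in>?W. \<Prod>\<alpha>\<in>P \<inter> \<Psi>. min 1 (\<bar>\<alpha> \<bullet> X\<bar> * pairing_norm (w ?\<mu>) (w ?\<nu>) (coroot \<alpha>)))
          \<le> (\<Sum>w\<in>?W. \<Prod>\<alpha>\<in>P \<inter> \<Psi>. min 1 (\<bar>\<alpha> \<bullet> X\<bar> * (?p w \<alpha> + 2 * E / x)))"
      proof (intro sum_mono prod_mono conjI min.mono order_refl mult_left_mono)
        fix w \<alpha> assume w: "w \<in> ?W" and \<alpha>: "\<alpha> \<in> P \<inter> \<Psi>"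
        have "pairing_norm (w ?\<mu>) (w ?\<nu>) (coroot \<alpha>) \<le> ?p w \<alpha> + cmod z * \<bar>w \<eta> \<bullet> coroot \<alpha>\<bar>"
          by (rule pairing_norm_shift[OF weyl_group_linear[OF w]])
        also have "cmod z * \<bar>w \<eta> \<bullet> coroot \<alpha>\<bar> \<le> cmod z * E"
          using E(2) w \<alpha> P by (intro mult_left_mono) auto
        finally show "pairing_norm (w ?\<mu>) (w ?\<nu>) (coroot \<alpha>) \<le> ?p w \<alpha> + 2 * E / x"
          by (simp add: z)
      qed auto
    qed (use c0 in \<open>auto intro!: sum_nonneg prod_nonneg\<close>)
    finally show "cmod (complex_alternant \<Phi> ?\<mu> ?\<nu> X) \<le> M"
      by (simp add: M_def)
  qed (use P \<eta> in auto)
  also have "\<dots> = c * (\<Sum>w\<in>?W. (\<Prod>\<alpha>\<in>P \<inter> \<Psi>. min 1 (\<bar>\<alpha> \<bullet> X\<bar> * (?p w \<alpha> + 2 * E / x))) *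
      (\<Prod>\<alpha>\<in>P. min 1 (x * pairing_norm \<mu> \<nu> (coroot \<alpha>))))"
    by (simp add: M_def sum_distrib_right)
  also have "\<dots> \<le> c * (\<Sum>w\<in>?W. ?D ^ card P * (\<Prod>\<alpha>\<in>P. min 1 (\<bar>\<alpha> \<bullet> X\<bar> * ?p w \<alpha>)))"
  proof (intro mult_left_mono sum_mono)
    fix w assume w: "w \<in> ?W"
    have "(\<Prod>\<alpha>\<in>P. min 1 (x * pairing_norm \<mu> \<nu> (coroot \<alpha>))) = (\<Prod>\<alpha>\<in>P. min 1 (x * ?p w \<alpha>))"
    proof -
      \<comment> \<open>Moving \<open>w\<close> from the covector to the root only permutes the roots up to sign.\<close>
      have "min 1 (x * ?p w (w \<alpha>)) = min 1 (x * pairing_norm \<mu> \<nu> (coroot \<alpha>))" for \<alpha>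
        by (simp add: pairing_norm_def coroot_image[OF w] weyl_group_inner[OF w])
      moreover have "?p w (- \<alpha>) = ?p w \<alpha>" for \<alpha>
        by (simp add: pairing_norm_def coroot_def cmod_def)
      ultimately show ?thesis
        using prod_positive_weyl_invariant[OF \<Phi> H, of "\<lambda>\<alpha>. min 1 (x * ?p w \<alpha>)" w] w x
        by (simp add: P)
    qed
    moreover have "(\<Prod>\<alpha>\<in>P \<inter> \<Psi>. min 1 (\<bar>\<alpha> \<bullet> X\<bar> * (?p w \<alpha> + 2 * E / x))) =
        (\<Prod>\<alpha>\<in>P. if \<alpha> \<in> \<Psi> then min 1 (\<bar>\<alpha> \<bullet> X\<bar> * (?p w \<alpha> + 2 * E / x)) else 1)"
      by (rule prod.inter_restrict[OF finP])
    ultimately have "(\<Prod>\<alpha>\<in>P \<inter> \<Psi>. min 1 (\<bar>\<alpha> \<bullet> X\<bar> * (?p w \<alpha> + 2 * E / x))) *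
        (\<Prod>\<alpha>\<in>P. min 1 (x * pairing_norm \<mu> \<nu> (coroot \<alpha>))) =
      (\<Prod>\<alpha>\<in>P. (if \<alpha> \<in> \<Psi> then min 1 (\<bar>\<alpha> \<bullet> X\<bar> * (?p w \<alpha> + 2 * E / x)) else 1) *
        min 1 (x * ?p w \<alpha>))"
      by (simp add: prod.distrib)
    also have "\<dots> \<le> (\<Prod>\<alpha>\<in>P. ?D * min 1 (\<bar>\<alpha> \<bullet> X\<bar> * ?p w \<alpha>))"
    proof (rule prod_mono, rule conjI)
      fix \<alpha> assume \<alpha>: "\<alpha> \<in> P"
      show "0 \<le> (if \<alpha> \<in> \<Psi> then min 1 (\<bar>\<alpha> \<bullet> X\<bar> * (?p w \<alpha> + 2 * E / x)) else 1) *
          min 1 (x * ?p w \<alpha>)"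
        using x E(1) by simp
      have nn: "0 \<le> min 1 (\<bar>\<alpha> \<bullet> X\<bar> * ?p w \<alpha>)"
        by simp
      show "(if \<alpha> \<in> \<Psi> then min 1 (\<bar>\<alpha> \<bullet> X\<bar> * (?p w \<alpha> + 2 * E / x)) else 1) *
          min 1 (x * ?p w \<alpha>) \<le> ?D * min 1 (\<bar>\<alpha> \<bullet> X\<bar> * ?p w \<alpha>)"
      proof (cases "\<alpha> \<in> \<Psi>")
        case True
        have "min 1 (\<bar>\<alpha> \<bullet> X\<bar> * (?p w \<alpha> + 2 * E / x)) * min 1 (x * ?p w \<alpha>)
            \<le> (1 + 2 * E) * min 1 (\<bar>\<alpha> \<bullet> X\<bar> * ?p w \<alpha>)"
          using x E(1) by (intro min_mult_min_le) auto
        also have "\<dots> \<le> ?D * min 1 (\<bar>\<alpha> \<bullet> X\<bar> * ?p w \<alpha>)"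
          using nn by (intro mult_right_mono) auto
        finally show ?thesis using True by simp
      next
        case False
        then have "min 1 (x * ?p w \<alpha>) \<le> L * min 1 (\<bar>\<alpha> \<bullet> X\<bar> * ?p w \<alpha>)"
          using L \<alpha> by (intro min_scale_le) auto
        also have "\<dots> \<le> ?D * min 1 (\<bar>\<alpha> \<bullet> X\<bar> * ?p w \<alpha>)"
          using nn by (intro mult_right_mono) auto
        finally show ?thesis using False by simp
      qed
    qed
    also have "\<dots> = ?D ^ card P * (\<Prod>\<alpha>\<in>P. min 1 (\<bar>\<alpha> \<bullet> X\<bar> * ?p w \<alpha>))"
      by (simp add: prod.distrib)
    finally show "(\<Prod>\<alpha>\<in>P \<inter> \<Psi>. min 1 (\<bar>\<alpha> \<bullet> X\<bar> * (?p w \<alpha> + 2 * E / x))) *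
        (\<Prod>\<alpha>\<in>P. min 1 (x * pairing_norm \<mu> \<nu> (coroot \<alpha>)))
      \<le> ?D ^ card P * (\<Prod>\<alpha>\<in>P. min 1 (\<bar>\<alpha> \<bullet> X\<bar> * ?p w \<alpha>))" .
  qed (rule c0)
  finally show ?thesis
    by (simp add: c_def mult_ac flip: sum_distrib_left)
qed

text \<open>
  Two of these ratios agree only on the hyperplane orthogonal to the difference of the two coroots,
  each rescaled by its value on \<open>\<eta>\<close>. That difference is nonzero because distinct positive roots of a
  reduced system are not proportional.
\<close>

lemma dense_distinct_zeros:
  fixes \<Phi> :: "'a::euclidean_space set"
  assumes \<Phi>: "root_system \<Phi>" and P: "P = {\<alpha>\<in>\<Phi>. 0 < \<alpha> \<bullet> H}"
    and \<eta>: "\<forall>\<alpha>\<in>\<Phi>. \<eta> \<bullet> coroot \<alpha> \<noteq> 0"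
  shows "closure {\<mu>. inj_on (\<lambda>\<alpha>. (\<mu> \<bullet> coroot \<alpha>) / (\<eta> \<bullet> coroot \<alpha>)) P} = UNIV"
    (is "closure ?B = UNIV")
proof -
  define d where "d = (\<lambda>(\<alpha>, \<beta>). (1 / (\<eta> \<bullet> coroot \<alpha>)) *\<^sub>R coroot \<alpha> -
    (1 / (\<eta> \<bullet> coroot \<beta>)) *\<^sub>R coroot \<beta>)"
  define S where "S = d ` {(\<alpha>, \<beta>). \<alpha> \<in> P \<and> \<beta> \<in> P \<and> \<alpha> \<noteq> \<beta>}"
  have finP: "finite P" using \<Phi> P by (simp add: root_system_def)
  let ?A = "{\<mu>. \<forall>v\<in>S. v \<bullet> \<mu> \<noteq> 0}"
  have "finite S"
    unfolding S_def by (rule finite_imageI, rule finite_subset[of _ "P \<times> P"]) (use finP in auto)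
  moreover have "0 \<notin> S"
  proof
    assume "0 \<in> S"
    then obtain \<alpha> \<beta> where ab: "\<alpha> \<in> P" "\<beta> \<in> P" "\<alpha> \<noteq> \<beta>" "d (\<alpha>, \<beta>) = 0"
      by (auto simp: S_def)
    have nz: "\<eta> \<bullet> coroot \<alpha> \<noteq> 0" "\<eta> \<bullet> coroot \<beta> \<noteq> 0" using \<eta> ab P by auto
    define a where "a = (1 / (\<eta> \<bullet> coroot \<alpha>)) * (2 / (\<alpha> \<bullet> \<alpha>))"
    define b where "b = (1 / (\<eta> \<bullet> coroot \<beta>)) * (2 / (\<beta> \<bullet> \<beta>))"
    have "\<alpha> \<noteq> 0" "\<beta> \<noteq> 0" using ab P \<Phi> by (auto simp: root_system_def)
    then have "a \<noteq> 0" "b \<noteq> 0" using nz by (auto simp: a_def b_def)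
    have eq: "a *\<^sub>R \<alpha> = b *\<^sub>R \<beta>"
      using ab(4) by (simp add: d_def a_def b_def coroot_def)
    have "(a / b) *\<^sub>R \<alpha> = (1 / b) *\<^sub>R (a *\<^sub>R \<alpha>)"
      by simp
    also have "\<dots> = \<beta>"
      using \<open>b \<noteq> 0\<close> by (simp add: eq)
    finally have \<beta>: "\<beta> = (a / b) *\<^sub>R \<alpha>" ..
    have "a / b = 1 \<or> a / b = -1"
    proof -
      have "\<alpha> \<in> \<Phi>" "(a / b) *\<^sub>R \<alpha> \<in> \<Phi>"
        using ab P unfolding \<beta>[symmetric] by auto
      then show ?thesis
        using \<Phi> unfolding root_system_def by blast
    qed
    moreover have "a / b \<noteq> -1"
    proof
      assume "a / b = -1"
      then have "\<beta> \<bullet> H = - (\<alpha> \<bullet> H)" using \<beta> by simp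
      then show False using ab P by simp
    qed
    ultimately show False using \<beta> ab(3) by simp
  qed
  ultimately have "closure ?A = UNIV"
    by (rule dense_off_hyperplanes)
  moreover have "?A \<subseteq> ?B"
  proof (intro subsetI CollectI inj_onI, rule ccontr)
    fix \<mu> \<alpha> \<beta>
    assume \<mu>: "\<mu> \<in> ?A" and ab: "\<alpha> \<in> P" "\<beta> \<in> P" "\<alpha> \<noteq> \<beta>"
      and eq: "(\<mu> \<bullet> coroot \<alpha>) / (\<eta> \<bullet> coroot \<alpha>) = (\<mu> \<bullet> coroot \<beta>) / (\<eta> \<bullet> coroot \<beta>)"
    have "d (\<alpha>, \<beta>) \<in> S"
      using ab by (auto simp: S_def)
    moreover have "d (\<alpha>, \<beta>) \<bullet> \<mu> = 0"
      using eq by (simp add: d_def inner_diff_right inner_commute[of _ \<mu>])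
    ultimately show False
      using \<mu> by blast
  qed
  ultimately show "closure ?B = UNIV"
    using closure_mono[of ?A ?B] by (simp only: top.extremum_unique)
qed

text \<open>
  The regular vector \<open>H\<close> stays the same in all subsystems, so that their positive roots are those of
  \<open>\<Phi>\<close> that they contain.
\<close>

lemma complex_alternant_bound:
  fixes \<Phi> :: "'a::euclidean_space set"
  assumes "finite \<Phi>" "root_system \<Phi>" "\<forall>\<alpha>\<in>\<Phi>. \<alpha> \<bullet> H \<noteq> 0"
  shows "\<exists>C. \<forall>\<mu> \<nu> X. cmod (complex_alternant \<Phi> \<mu> \<nu> X) \<le> C * exp (growth \<Phi> \<nu> X) *
    (\<Sum>w\<in>weyl_group \<Phi>. \<Prod>\<alpha> | \<alpha> \<in> \<Phi> \<and> 0 < \<alpha> \<bullet> H.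
      min 1 (\<bar>\<alpha> \<bullet> X\<bar> * pairing_norm (w \<mu>) (w \<nu>) (coroot \<alpha>)))"
  using assms
proof (induction \<Phi> rule: finite_psubset_induct)
  case (psubset \<Phi>)
  note \<Phi> = \<open>root_system \<Phi>\<close> and H = \<open>\<forall>\<alpha>\<in>\<Phi>. \<alpha> \<bullet> H \<noteq> 0\<close>
  show ?case
  proof (cases "\<Phi> = {}")
    case True
    then show ?thesis
      by (intro exI[of _ 1]) (simp add: weyl_group_empty complex_alternant_bound_empty)
  next
    case False
    let ?W = "weyl_group \<Phi>"
    define P where "P = {\<alpha>\<in>\<Phi>. 0 < \<alpha> \<bullet> H}"
    define R where "R \<Psi> \<mu> \<nu> X = (\<Sum>w\<in>weyl_group \<Psi>. \<Prod>\<alpha>\<in>P \<inter> \<Psi>.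
      min 1 (\<bar>\<alpha> \<bullet> X\<bar> * pairing_norm (w \<mu>) (w \<nu>) (coroot \<alpha>)))" for \<Psi> \<mu> \<nu> X
    have R0: "0 \<le> R \<Psi> \<mu> \<nu> X" for \<Psi> \<mu> \<nu> X
      unfolding R_def by (auto intro!: sum_nonneg prod_nonneg)
    have "\<exists>C\<ge>1. \<forall>\<Psi>\<in>{\<Psi>. \<Psi> \<subset> \<Phi> \<and> root_system \<Psi>}. \<forall>\<mu> \<nu> X.
        cmod (complex_alternant \<Psi> \<mu> \<nu> X) \<le> C * exp (growth \<Psi> \<nu> X) * R \<Psi> \<mu> \<nu> X"
    proof (rule uniform_constant)
      show "finite {\<Psi>. \<Psi> \<subset> \<Phi> \<and> root_system \<Psi>}"
        by (rule finite_subset[of _ "Pow \<Phi>"]) (use psubset.hyps in auto)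
    next
      fix \<Psi> assume \<Psi>: "\<Psi> \<in> {\<Psi>. \<Psi> \<subset> \<Phi> \<and> root_system \<Psi>}"
      then have "{\<alpha>. \<alpha> \<in> \<Psi> \<and> 0 < \<alpha> \<bullet> H} = P \<inter> \<Psi>"
        by (auto simp: P_def)
      then show "\<exists>C. \<forall>\<mu> \<nu> X.
          cmod (complex_alternant \<Psi> \<mu> \<nu> X) \<le> C * exp (growth \<Psi> \<nu> X) * R \<Psi> \<mu> \<nu> X"
        using psubset.IH[of \<Psi>] \<Psi> H unfolding R_def by auto
    next
      fix \<Psi> and C C' :: real
      assume "C \<le> C'" and C: "\<forall>\<mu> \<nu> X.
          cmod (complex_alternant \<Psi> \<mu> \<nu> X) \<le> C * exp (growth \<Psi> \<nu> X) * R \<Psi> \<mu> \<nu> X"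
      then have "C * exp (growth \<Psi> \<nu> X) * R \<Psi> \<mu> \<nu> X \<le> C' * exp (growth \<Psi> \<nu> X) * R \<Psi> \<mu> \<nu> X" for \<mu> \<nu> X
        by (intro mult_right_mono R0) auto
      then show "\<forall>\<mu> \<nu> X.
          cmod (complex_alternant \<Psi> \<mu> \<nu> X) \<le> C' * exp (growth \<Psi> \<nu> X) * R \<Psi> \<mu> \<nu> X"
        using C order_trans by blast
    qed
    then obtain C0 where "C0 \<ge> 1" and C0: "\<And>\<Psi> \<mu> \<nu> X. \<Psi> \<subset> \<Phi> \<Longrightarrow> root_system \<Psi> \<Longrightarrow>
        cmod (complex_alternant \<Psi> \<mu> \<nu> X) \<le> C0 * exp (growth \<Psi> \<nu> X) * R \<Psi> \<mu> \<nu> X"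
      by blast
    obtain L where "L \<ge> 1" and L: "\<And>X x. 0 < x \<Longrightarrow> \<forall>\<alpha>\<in>\<Phi>. \<bar>\<alpha> \<bullet> X\<bar> \<le> x \<Longrightarrow> \<exists>\<alpha>\<in>\<Phi>. \<bar>\<alpha> \<bullet> X\<bar> = x \<Longrightarrow>
        \<exists>S\<subseteq>\<Phi>. \<not> \<Phi> \<subseteq> span S \<and> (\<forall>\<alpha>\<in>\<Phi> - span S. x \<le> L * \<bar>\<alpha> \<bullet> X\<bar>)"
      using exists_proper_flat[OF psubset.hyps] by blast
    obtain \<eta> where \<eta>: "\<eta> \<in> span \<Phi>" "\<forall>\<alpha>\<in>\<Phi>. 1 \<le> \<bar>\<eta> \<bullet> coroot \<alpha>\<bar>"
      using regular_direction_in_span[OF psubset.hyps H] by blast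
    have finW: "finite ?W" by (rule finite_weyl_group[OF \<Phi>])
    have "\<exists>B\<ge>1. \<forall>v\<in>(\<lambda>w. w \<eta>) ` ?W. \<forall>X m. 0 \<le> m \<longrightarrow> (\<forall>s\<in>\<Phi>. \<bar>s \<bullet> X\<bar> \<le> m) \<longrightarrow> \<bar>v \<bullet> X\<bar> \<le> B * m"
      by (rule span_inner_bound_uniform) (use finW weyl_group_image_span[OF \<Phi>] \<eta>(1) in auto)
    then obtain B where B: "\<And>w X m. w \<in> ?W \<Longrightarrow> 0 \<le> m \<Longrightarrow> \<forall>s\<in>\<Phi>. \<bar>s \<bullet> X\<bar> \<le> m \<Longrightarrow> \<bar>w \<eta> \<bullet> X\<bar> \<le> B * m"
      by blast
    have "\<exists>E\<ge>1. \<forall>y\<in>?W \<times> \<Phi>. \<bar>(fst y) \<eta> \<bullet> coroot (snd y)\<bar> \<le> E"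
      by (rule uniform_constant) (use finW psubset.hyps in auto)
    then obtain E where E: "E \<ge> 1" "\<forall>w\<in>?W. \<forall>\<alpha>\<in>\<Phi>. \<bar>w \<eta> \<bullet> coroot \<alpha>\<bar> \<le> E"
      by auto
    define C where "C = C0 * exp (2 * B * card ?W) * max (1 + 2 * E) L ^ card P"
    have "0 \<le> C"
      using \<open>C0 \<ge> 1\<close> \<open>L \<ge> 1\<close> by (simp add: C_def)
    have "cmod (complex_alternant \<Phi> \<mu> \<nu> X) \<le> C * exp (growth \<Phi> \<nu> X) * R \<Phi> \<mu> \<nu> X" for \<mu> \<nu> X
    proof -
      define x where "x = Max ((\<lambda>\<alpha>. \<bar>\<alpha> \<bullet> X\<bar>) ` \<Phi>)"
      have "x \<in> (\<lambda>\<alpha>. \<bar>\<alpha> \<bullet> X\<bar>) ` \<Phi>"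
        unfolding x_def using psubset.hyps False by (intro Max_in) auto
      then have x: "\<forall>\<alpha>\<in>\<Phi>. \<bar>\<alpha> \<bullet> X\<bar> \<le> x" "\<exists>\<alpha>\<in>\<Phi>. \<bar>\<alpha> \<bullet> X\<bar> = x"
        using psubset.hyps by (auto simp: x_def)
      then have "0 \<le> x" by auto
      show ?thesis
      proof (cases "x = 0")
        case True
        \<comment> \<open>All roots vanish on \<open>X\<close>, so there is no scale for the circle in \<open>\<lambda>\<close>.\<close>
        then obtain \<alpha> where "\<alpha> \<in> \<Phi>" "\<alpha> \<bullet> X = 0" using x by auto
        then have "complex_alternant \<Phi> \<mu> \<nu> X = 0"
          by (rule complex_alternant_eq_0_of_root_zero[OF \<Phi>])
        then show ?thesis
          using \<open>0 \<le> C\<close> R0[of \<Phi> \<mu> \<nu> X] by simp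
      next
        case False
        then have "0 < x" using \<open>0 \<le> x\<close> by simp
        obtain S where S: "S \<subseteq> \<Phi>" "\<not> \<Phi> \<subseteq> span S" "\<forall>\<alpha>\<in>\<Phi> - span S. x \<le> L * \<bar>\<alpha> \<bullet> X\<bar>"
          using L[OF \<open>0 < x\<close> x] by blast
        define \<Psi> where "\<Psi> = \<Phi> \<inter> span S"
        have \<Psi>: "root_system \<Psi>" "\<Psi> \<subset> \<Phi>"
          using root_system_Int_span[OF \<Phi>] S(2) by (auto simp: \<Psi>_def)
        have P\<Phi>: "P \<inter> \<Phi> = P" by (auto simp: P_def)
        let ?G = "{\<mu>. inj_on (\<lambda>\<alpha>. (\<mu> \<bullet> coroot \<alpha>) / (\<eta> \<bullet> coroot \<alpha>)) P}"
        let ?F = "\<lambda>\<mu>. cmod (complex_alternant \<Phi> \<mu> \<nu> X) - C * exp (growth \<Phi> \<nu> X) * R \<Phi> \<mu> \<nu> X"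
        have generic: "?F \<mu> \<le> 0"
          if "\<mu> \<in> ?G" for \<mu>
        proof -
          have "cmod (complex_alternant \<Phi> \<mu> \<nu> X) \<le>
            C0 * exp (2 * B * card ?W) * max (1 + 2 * E) L ^ card P * exp (growth \<Phi> \<nu> X) *
            (\<Sum>w\<in>?W. \<Prod>\<alpha>\<in>P. min 1 (\<bar>\<alpha> \<bullet> X\<bar> * pairing_norm (w \<mu>) (w \<nu>) (coroot \<alpha>)))"
          proof (rule complex_alternant_bound_generic[OF \<Phi> \<Psi>(1) _ H P_def])
            show "cmod (complex_alternant \<Psi> \<mu> \<nu> X) \<le> C0 * exp (growth \<Psi> \<nu> X) *
                (\<Sum>w\<in>weyl_group \<Psi>. \<Prod>\<alpha>\<in>P \<inter> \<Psi>.
                  min 1 (\<bar>\<alpha> \<bullet> X\<bar> * pairing_norm (w \<mu>) (w \<nu>) (coroot \<alpha>)))" for \<mu> \<nu>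
              using C0[OF \<Psi>(2,1)] unfolding R_def .
            show "\<forall>w\<in>?W. \<bar>w \<eta> \<bullet> X\<bar> \<le> B * x"
              using B x(1) \<open>0 \<le> x\<close> by blast
            show "\<forall>\<alpha>\<in>P - \<Psi>. x \<le> L * \<bar>\<alpha> \<bullet> X\<bar>"
              using S(3) by (auto simp: P_def \<Psi>_def)
          qed (use \<Psi> \<open>C0 \<ge> 1\<close> \<open>0 < x\<close> \<open>L \<ge> 1\<close> \<eta> E that in auto)
          then show ?thesis
            by (simp add: C_def R_def P\<Phi>)
        qed
        have cont: "continuous_on UNIV ?F"
        proof -
          have "continuous_on UNIV w" if "w \<in> ?W" for w
            using weyl_group_linear[OF that] by (simp add: linear_continuous_on linear_linear)
          then show ?thesis
            unfolding complex_alternant_def R_def pairing_norm_def Complex_eq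
            by (intro continuous_intros) auto
        qed
        have dense: "closure ?G = UNIV"
          using \<eta>(2) by (intro dense_distinct_zeros[OF \<Phi> P_def]) force
        have "?F \<mu> \<le> 0"
          by (rule continuous_le_on_closure[where S = ?G]) (use cont dense generic in simp_all)
        then show ?thesis by simp
      qed
    qed
    moreover have "P \<inter> \<Phi> = {\<alpha>. \<alpha> \<in> \<Phi> \<and> 0 < \<alpha> \<bullet> H}"
      by (auto simp: P_def)
    ultimately show ?thesis
      unfolding R_def by (intro exI[of _ C]) simp
  qed
qed

theorem theorem1p1:
  fixes \<Phi> :: "'a::euclidean_space set"
  assumes "root_system \<Phi>"
  shows "\<exists>C::real. C > 0 \<and>
    (\<forall>P. positive_system \<Phi> P \<longrightarrow>
      (\<forall>\<mu> X. cmod (weyl_alternant \<Phi> \<mu> X) \<le>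
        C * (\<Sum>w\<in>weyl_group \<Phi>. \<Prod>\<alpha>\<in>P. min 1 (\<bar>\<alpha> \<bullet> X\<bar> * \<bar>w \<mu> \<bullet> coroot \<alpha>\<bar>))))"
proof -
  have fin: "finite \<Phi>" using assms by (simp add: root_system_def)
  have w0: "w 0 = 0" if "w \<in> weyl_group \<Phi>" for w
    using linear_0[OF weyl_group_linear[OF that]] .
  have "\<exists>C\<ge>1. \<forall>P\<in>{P. positive_system \<Phi> P}. \<forall>\<mu> X. cmod (weyl_alternant \<Phi> \<mu> X) \<le>
      C * (\<Sum>w\<in>weyl_group \<Phi>. \<Prod>\<alpha>\<in>P. min 1 (\<bar>\<alpha> \<bullet> X\<bar> * \<bar>w \<mu> \<bullet> coroot \<alpha>\<bar>))"
  proof (rule uniform_constant)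
    show "finite {P. positive_system \<Phi> P}"
      by (rule finite_subset[of _ "Pow \<Phi>"]) (use fin in \<open>auto simp: positive_system_def\<close>)
  next
    fix P assume "P \<in> {P. positive_system \<Phi> P}"
    then obtain H where H: "\<forall>\<alpha>\<in>\<Phi>. \<alpha> \<bullet> H \<noteq> 0" "P = {\<alpha>\<in>\<Phi>. 0 < \<alpha> \<bullet> H}"
      by (auto simp: positive_system_def)
    obtain C where C: "cmod (complex_alternant \<Phi> \<mu> \<nu> X) \<le> C * exp (growth \<Phi> \<nu> X) *
        (\<Sum>w\<in>weyl_group \<Phi>. \<Prod>\<alpha>\<in>P. min 1 (\<bar>\<alpha> \<bullet> X\<bar> * pairing_norm (w \<mu>) (w \<nu>) (coroot \<alpha>)))" for \<mu> \<nu> X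
      using complex_alternant_bound[OF fin assms H(1)] unfolding H(2) by blast
    have "complex_alternant \<Phi> \<mu> 0 X = weyl_alternant \<Phi> \<mu> X" for \<mu> X
      unfolding complex_alternant_def weyl_alternant_def
      by (intro sum.cong refl) (simp add: w0 Complex_eq)
    moreover have "growth \<Phi> 0 X = 0" for X
      unfolding growth_def by (simp add: w0)
    moreover have "(\<Sum>w\<in>weyl_group \<Phi>. \<Prod>\<alpha>\<in>P.
          min 1 (\<bar>\<alpha> \<bullet> X\<bar> * pairing_norm (w \<mu>) (w 0) (coroot \<alpha>)))
        = (\<Sum>w\<in>weyl_group \<Phi>. \<Prod>\<alpha>\<in>P. min 1 (\<bar>\<alpha> \<bullet> X\<bar> * \<bar>w \<mu> \<bullet> coroot \<alpha>\<bar>))" for \<mu> X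
      by (intro sum.cong refl) (simp add: w0 pairing_norm_def cmod_def)
    ultimately show "\<exists>C. \<forall>\<mu> X. cmod (weyl_alternant \<Phi> \<mu> X) \<le>
        C * (\<Sum>w\<in>weyl_group \<Phi>. \<Prod>\<alpha>\<in>P. min 1 (\<bar>\<alpha> \<bullet> X\<bar> * \<bar>w \<mu> \<bullet> coroot \<alpha>\<bar>))"
      using C[of _ 0] by (intro exI[of _ C]) simp
  next
    fix P and C C' :: real
    assume "C \<le> C'" and C: "\<forall>\<mu> X. cmod (weyl_alternant \<Phi> \<mu> X) \<le>
        C * (\<Sum>w\<in>weyl_group \<Phi>. \<Prod>\<alpha>\<in>P. min 1 (\<bar>\<alpha> \<bullet> X\<bar> * \<bar>w \<mu> \<bullet> coroot \<alpha>\<bar>))"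
    then have "C * (\<Sum>w\<in>weyl_group \<Phi>. \<Prod>\<alpha>\<in>P. min 1 (\<bar>\<alpha> \<bullet> X\<bar> * \<bar>w \<mu> \<bullet> coroot \<alpha>\<bar>))
        \<le> C' * (\<Sum>w\<in>weyl_group \<Phi>. \<Prod>\<alpha>\<in>P. min 1 (\<bar>\<alpha> \<bullet> X\<bar> * \<bar>w \<mu> \<bullet> coroot \<alpha>\<bar>))" for \<mu> X
      by (intro mult_right_mono) (auto intro!: sum_nonneg prod_nonneg)
    then show "\<forall>\<mu> X. cmod (weyl_alternant \<Phi> \<mu> X) \<le>
        C' * (\<Sum>w\<in>weyl_group \<Phi>. \<Prod>\<alpha>\<in>P. min 1 (\<bar>\<alpha> \<bullet> X\<bar> * \<bar>w \<mu> \<bullet> coroot \<alpha>\<bar>))"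
      using C order_trans by blast
  qed
  then obtain C where "C \<ge> 1" "\<forall>P\<in>{P. positive_system \<Phi> P}. \<forall>\<mu> X. cmod (weyl_alternant \<Phi> \<mu> X) \<le>
      C * (\<Sum>w\<in>weyl_group \<Phi>. \<Prod>\<alpha>\<in>P. min 1 (\<bar>\<alpha> \<bullet> X\<bar> * \<bar>w \<mu> \<bullet> coroot \<alpha>\<bar>))"
    by blast
  then show ?thesis
    by (intro exI[of _ C]) auto
qed

end
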